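(* The representation $\psi: B_\bullet\to\mathrm{Aut}(F_\bullet)$ is an embedding, i.e., it is injective.
   Context: $B_\bullet$ is the group (of parenthesized braids) presented by generators $\sigma_i,a_i$ ($i\ge1$) and the relations, for all $i\ge1$ and $j\ge i+2$: $\sigma_i\sigma_j=\sigma_j\sigma_i$, $\sigma_ia_j=a_j\sigma_i$, $a_ia_{j-1}=a_ja_i$, $a_i\sigma_{j-1}=\sigma_ja_i$, $\sigma_i\sigma_{i+1}\sigma_i=\sigma_{i+1}\sigma_i\sigma_{i+1}$, $\sigma_{i+1}\sigma_ia_{i+1}=a_i\sigma_i$, $\sigma_i\sigma_{i+1}a_i=a_{i+1}\sigma_i$. $F_\bullet$ is the free group with basis $\{x_s\}$, where $s$ ranges over all finite nonempty sequences of positive integers; for an integer $j$ and a possibly empty sequence $s$, $x_{j,s}$ denotes the generator indexed by $j$ followed by $s$. The homomorphism $\psi$ (with $\psi(xy)=\psi(x)\circ\psi(y)$) is determined by the following formulas, where $s$ is any possibly empty sequence of positive integers: $\psi(\sigma_i)$: $x_{j,s}\mapsto x_{j,s}$ for $j\ne i,i+1$; $x_{i,s}\mapsto x_ix_{i+1,s}x_i^{-1}$; $x_{i+1,s}\mapsto x_{i,s}$. $\psi(a_i)$: $x_{j,s}\mapsto x_{j,s}$ for $j<i$; $x_{j,s}\mapsto x_{j+1,s}$ for $j>i$; $x_i\mapsto x_ix_{i+1}$; $x_{i,1,s}\mapsto x_{i,s}$; $x_{i,j+1,s}\mapsto x_{i+1,j,s}$ for $j\ge1$. *)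

theory Defs
  imports "HOL-Algebra.Bij"
begin

section \<open>Groups presented by generators and relations\<close>

text \<open>A letter \<open>(g, True)\<close> stands for the generator \<open>g\<close>, and \<open>(g, False)\<close> for its formal inverse.
  A relation \<open>u = v\<close> is a pair of words \<open>(u, v)\<close>.\<close>

type_synonym 'g word = "('g \<times> bool) list"

definition words :: "'g set \<Rightarrow> 'g word set" where
  "words S = lists (S \<times> UNIV)"

inductive_set pres_cong :: "'g set \<Rightarrow> ('g word \<times> 'g word) set \<Rightarrow> ('g word \<times> 'g word) set"
  for S :: "'g set" and R :: "('g word \<times> 'g word) set" where
  refl: "w \<in> words S \<Longrightarrow> (w, w) \<in> pres_cong S R"
| sym: "(u, v) \<in> pres_cong S R \<Longrightarrow> (v, u) \<in> pres_cong S R"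
| trans: "(u, v) \<in> pres_cong S R \<Longrightarrow> (v, w) \<in> pres_cong S R \<Longrightarrow> (u, w) \<in> pres_cong S R"
| append: "(u, u') \<in> pres_cong S R \<Longrightarrow> (v, v') \<in> pres_cong S R \<Longrightarrow> (u @ v, u' @ v') \<in> pres_cong S R"
| cancel: "g \<in> S \<Longrightarrow> ([(g, b), (g, \<not> b)], []) \<in> pres_cong S R"
| rel: "(u, v) \<in> R \<Longrightarrow> u \<in> words S \<Longrightarrow> v \<in> words S \<Longrightarrow> (u, v) \<in> pres_cong S R"

definition pres_class :: "'g set \<Rightarrow> ('g word \<times> 'g word) set \<Rightarrow> 'g word \<Rightarrow> 'g word set" where
  "pres_class S R w = pres_cong S R `` {w}"

definition presented_group :: "'g set \<Rightarrow> ('g word \<times> 'g word) set \<Rightarrow> 'g word set monoid" where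
  "presented_group S R =
    \<lparr>carrier = words S // pres_cong S R,
     mult = \<lambda>A B. \<Union>u\<in>A. \<Union>v\<in>B. pres_class S R (u @ v),
     one = pres_class S R []\<rparr>"

definition free_group :: "'g set \<Rightarrow> 'g word set monoid" where
  "free_group S = presented_group S {}"

definition word_eval :: "('h, 'm) monoid_scheme \<Rightarrow> ('g \<Rightarrow> 'h) \<Rightarrow> 'g word \<Rightarrow> 'h" where
  "word_eval H f w =
     foldr (\<lambda>(g, b) y. (if b then f g else inv\<^bsub>H\<^esub> (f g)) \<otimes>\<^bsub>H\<^esub> y) w \<one>\<^bsub>H\<^esub>"

text \<open>The homomorphism from \<open>presented_group S R\<close> to \<open>H\<close> with prescribed values \<open>f\<close> on the
  generators. The value on a congruence class is the common value of \<open>word_eval\<close> on its elements,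
  so this is meaningful only if \<open>f\<close> respects the relations.\<close>

definition pres_hom ::
  "'g set \<Rightarrow> ('g word \<times> 'g word) set \<Rightarrow> ('h, 'm) monoid_scheme \<Rightarrow> ('g \<Rightarrow> 'h) \<Rightarrow> 'g word set \<Rightarrow> 'h" where
  "pres_hom S R H f = (\<lambda>C \<in> carrier (presented_group S R). the_elem (word_eval H f ` C))"

lemma words_simps [simp]:
  "[] \<in> words S"
  "x # w \<in> words S \<longleftrightarrow> fst x \<in> S \<and> w \<in> words S"
  "u @ v \<in> words S \<longleftrightarrow> u \<in> words S \<and> v \<in> words S"
  by (auto simp: words_def mem_Times_iff)

lemma pres_cong_words: "(u, v) \<in> pres_cong S R \<Longrightarrow> u \<in> words S \<and> v \<in> words S"
  by (induction rule: pres_cong.induct) auto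

lemma equiv_pres_cong: "equiv (words S) (pres_cong S R)"
proof (rule equivI)
  show "pres_cong S R \<subseteq> words S \<times> words S" using pres_cong_words by fast
  show "refl_on (words S) (pres_cong S R)" by (rule refl_onI) (rule pres_cong.refl)
  show "sym_on UNIV (pres_cong S R)" by (rule symI) (rule pres_cong.sym)
  show "trans_on UNIV (pres_cong S R)" by (rule transI) (rule pres_cong.trans)
qed

lemma pres_class_eq_iff:
  "u \<in> words S \<Longrightarrow> v \<in> words S \<Longrightarrow> pres_class S R u = pres_class S R v \<longleftrightarrow> (u, v) \<in> pres_cong S R"
  unfolding pres_class_def by (rule eq_equiv_class_iff [OF equiv_pres_cong])

lemma pres_class_in_carrier [simp]:
  "w \<in> words S \<Longrightarrow> pres_class S R w \<in> carrier (presented_group S R)"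
  by (auto simp: presented_group_def pres_class_def intro: quotientI)

lemma presented_group_cases:
  assumes "C \<in> carrier (presented_group S R)"
  obtains w where "w \<in> words S" "C = pres_class S R w"
  using assms by (auto simp: presented_group_def pres_class_def elim: quotientE)

lemma pres_class_mult [simp]:
  assumes "u \<in> words S" "v \<in> words S"
  shows "pres_class S R u \<otimes>\<^bsub>presented_group S R\<^esub> pres_class S R v = pres_class S R (u @ v)"
proof -
  have c: "pres_class S R (u' @ v') = pres_class S R (u @ v)"
    if "u' \<in> pres_class S R u" "v' \<in> pres_class S R v" for u' v'
  proof -
    have "(u, u') \<in> pres_cong S R" "(v, v') \<in> pres_cong S R"
      using that by (auto simp: pres_class_def)
    then have "(u @ v, u' @ v') \<in> pres_cong S R" by (rule pres_cong.append)
    then show ?thesis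
      by (metis pres_class_eq_iff pres_cong_words)
  qed
  have "pres_class S R u \<noteq> {}" "pres_class S R v \<noteq> {}"
    using assms pres_cong.refl by (fastforce simp: pres_class_def)+
  moreover have "(\<Union>u'\<in>pres_class S R u. \<Union>v'\<in>pres_class S R v. pres_class S R (u' @ v')) =
      (\<Union>u'\<in>pres_class S R u. \<Union>v'\<in>pres_class S R v. pres_class S R (u @ v))"
    by (intro SUP_cong HOL.refl c)
  ultimately show ?thesis by (simp add: presented_group_def)
qed

lemma presented_group_one: "\<one>\<^bsub>presented_group S R\<^esub> = pres_class S R []"
  by (simp add: presented_group_def)

definition word_inv :: "'g word \<Rightarrow> 'g word" where
  "word_inv w = rev (map (\<lambda>(g, b). (g, \<not> b)) w)"

lemma word_inv_words [simp]: "word_inv w \<in> words S \<longleftrightarrow> w \<in> words S"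
  by (induction w) (auto simp: word_inv_def)

lemma word_inv_cong: "w \<in> words S \<Longrightarrow> (word_inv w @ w, []) \<in> pres_cong S R"
proof (induction w)
  case Nil
  then show ?case by (simp add: word_inv_def pres_cong.refl)
next
  case (Cons x w)
  obtain g b where x: "x = (g, b)" by force
  have g: "g \<in> S" and w: "w \<in> words S" using Cons.prems x by auto
  have "([(g, \<not> b), (g, \<not> \<not> b)], []) \<in> pres_cong S R" using g by (rule pres_cong.cancel)
  then have "([(g, \<not> b), (g, b)] @ w, [] @ w) \<in> pres_cong S R"
    using w by (intro pres_cong.append [OF _ pres_cong.refl]) auto
  then have "(word_inv w @ [(g, \<not> b), (g, b)] @ w, word_inv w @ [] @ w) \<in> pres_cong S R"
    using w by (intro pres_cong.append [OF pres_cong.refl]) auto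
  with Cons.IH [OF w] show ?case
    by (auto simp: word_inv_def x intro: pres_cong.trans)
qed

theorem group_presented_group: "group (presented_group S R)"
proof (rule groupI)
  fix x y z
  assume "x \<in> carrier (presented_group S R)" "y \<in> carrier (presented_group S R)"
  then show "x \<otimes>\<^bsub>presented_group S R\<^esub> y \<in> carrier (presented_group S R)"
    by (elim presented_group_cases) simp
next
  fix x y z
  assume "x \<in> carrier (presented_group S R)" "y \<in> carrier (presented_group S R)"
    "z \<in> carrier (presented_group S R)"
  then show "x \<otimes>\<^bsub>presented_group S R\<^esub> y \<otimes>\<^bsub>presented_group S R\<^esub> z =
    x \<otimes>\<^bsub>presented_group S R\<^esub> (y \<otimes>\<^bsub>presented_group S R\<^esub> z)"
    by (elim presented_group_cases) simp
next
  fix x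
  assume "x \<in> carrier (presented_group S R)"
  then obtain w where w: "w \<in> words S" "x = pres_class S R w" by (elim presented_group_cases)
  then show "\<one>\<^bsub>presented_group S R\<^esub> \<otimes>\<^bsub>presented_group S R\<^esub> x = x"
    by (simp add: presented_group_one)
  show "\<exists>y\<in>carrier (presented_group S R). y \<otimes>\<^bsub>presented_group S R\<^esub> x = \<one>\<^bsub>presented_group S R\<^esub>"
    by (rule bexI [where x = "pres_class S R (word_inv w)"])
       (auto simp: w presented_group_one pres_class_eq_iff word_inv_cong)
qed (simp add: presented_group_one)

lemma group_free_group: "group (free_group S)"
  by (simp add: free_group_def group_presented_group)

context group
begin

lemma word_eval_closed:
  "f \<in> S \<rightarrow> carrier G \<Longrightarrow> w \<in> words S \<Longrightarrow> word_eval G f w \<in> carrier G"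
  by (induction w) (auto simp: word_eval_def Pi_iff)

lemma word_eval_append:
  assumes "f \<in> S \<rightarrow> carrier G" "u \<in> words S" "v \<in> words S"
  shows "word_eval G f (u @ v) = word_eval G f u \<otimes> word_eval G f v"
  using assms(2)
proof (induction u)
  case Nil
  then show ?case using word_eval_closed [OF assms(1,3)] by (simp add: word_eval_def)
next
  case (Cons x u)
  then have "word_eval G f u \<in> carrier G" "word_eval G f v \<in> carrier G" "f (fst x) \<in> carrier G"
    using assms word_eval_closed by auto
  with Cons show ?case
    by (auto simp: word_eval_def m_assoc split: prod.splits)
qed

lemma word_eval_cong:
  assumes f: "f \<in> S \<rightarrow> carrier G"
    and R: "\<And>u v. (u, v) \<in> R \<Longrightarrow> u \<in> words S \<Longrightarrow> v \<in> words S \<Longrightarrow> word_eval G f u = word_eval G f v"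
    and "(u, v) \<in> pres_cong S R"
  shows "word_eval G f u = word_eval G f v"
  using assms(3)
proof (induction rule: pres_cong.induct)
  case (append u u' v v')
  then show ?case using word_eval_append [OF f] pres_cong_words by metis
next
  case (cancel g b)
  then have "f g \<in> carrier G" using f by auto
  then show ?case by (auto simp: word_eval_def)
qed (auto intro: R)

lemma pres_hom_class:
  assumes f: "f \<in> S \<rightarrow> carrier G"
    and R: "\<And>u v. (u, v) \<in> R \<Longrightarrow> u \<in> words S \<Longrightarrow> v \<in> words S \<Longrightarrow> word_eval G f u = word_eval G f v"
    and w: "w \<in> words S"
  shows "pres_hom S R G f (pres_class S R w) = word_eval G f w"
proof -
  have "word_eval G f ` pres_class S R w = {word_eval G f w}"
  proof -
    have "w \<in> pres_class S R w"
      using w by (simp add: pres_class_def pres_cong.refl)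
    moreover have "word_eval G f v = word_eval G f w" if "v \<in> pres_class S R w" for v
      using word_eval_cong [OF f R] that by (simp add: pres_class_def)
    ultimately show ?thesis by blast
  qed
  then show ?thesis using w by (simp add: pres_hom_def)
qed

theorem pres_hom_hom:
  assumes f: "f \<in> S \<rightarrow> carrier G"
    and R: "\<And>u v. (u, v) \<in> R \<Longrightarrow> u \<in> words S \<Longrightarrow> v \<in> words S \<Longrightarrow> word_eval G f u = word_eval G f v"
  shows "pres_hom S R G f \<in> hom (presented_group S R) G"
proof (rule homI)
  fix x assume "x \<in> carrier (presented_group S R)"
  then show "pres_hom S R G f x \<in> carrier G"
    by (elim presented_group_cases) (simp add: pres_hom_class [OF f R] word_eval_closed [OF f])
next
  fix x y assume "x \<in> carrier (presented_group S R)" "y \<in> carrier (presented_group S R)"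
  then show "pres_hom S R G f (x \<otimes>\<^bsub>presented_group S R\<^esub> y) = pres_hom S R G f x \<otimes> pres_hom S R G f y"
    by (elim presented_group_cases) (simp add: pres_hom_class [OF f R] word_eval_append [OF f])
qed

theorem pres_hom_generator:
  assumes f: "f \<in> S \<rightarrow> carrier G"
    and R: "\<And>u v. (u, v) \<in> R \<Longrightarrow> u \<in> words S \<Longrightarrow> v \<in> words S \<Longrightarrow> word_eval G f u = word_eval G f v"
    and "g \<in> S"
  shows "pres_hom S R G f (pres_class S R [(g, True)]) = f g"
proof -
  have "f g \<in> carrier G" using f \<open>g \<in> S\<close> by auto
  moreover have "pres_hom S R G f (pres_class S R [(g, True)]) = word_eval G f [(g, True)]"
    by (rule pres_hom_class [OF f R]) (use \<open>g \<in> S\<close> in auto)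
  ultimately show ?thesis by (simp add: word_eval_def)
qed

end

lemma hom_class_eq_word_eval:
  assumes H: "group H" and h: "h \<in> hom (presented_group S R) H" and w: "w \<in> words S"
  shows "h (pres_class S R w) = word_eval H (\<lambda>g. h (pres_class S R [(g, True)])) w"
proof -
  interpret H: group H by fact
  interpret P: group "presented_group S R" by (rule group_presented_group)
  interpret group_hom "presented_group S R" H h
    by unfold_locales (rule h)
  show ?thesis
    using w
  proof (induction w)
    case Nil
    then show ?case using hom_one by (simp add: word_eval_def presented_group_one)
  next
    case (Cons x w)
    obtain g b where x: "x = (g, b)" by force
    have g: "g \<in> S" and w: "w \<in> words S" using Cons.prems x by auto
    have inv: "pres_class S R [(g, False)] = inv\<^bsub>presented_group S R\<^esub> pres_class S R [(g, True)]"
      using g pres_cong.cancel [of g S False R]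
      by (intro P.inv_equality [symmetric]) (auto simp: presented_group_one pres_class_eq_iff)
    have "pres_class S R (x # w) = pres_class S R [x] \<otimes>\<^bsub>presented_group S R\<^esub> pres_class S R w"
      using g w x by simp
    then have "h (pres_class S R (x # w)) = h (pres_class S R [x]) \<otimes>\<^bsub>H\<^esub> h (pres_class S R w)"
      using g w x by (simp del: pres_class_mult)
    also have "h (pres_class S R [x]) =
      (if b then h (pres_class S R [(g, True)]) else inv\<^bsub>H\<^esub> h (pres_class S R [(g, True)]))"
      using g x inv by (cases b) auto
    finally show ?case using Cons.IH [OF w] x by (simp add: word_eval_def)
  qed
qed

theorem pres_hom_unique:
  assumes "group H" "h \<in> hom (presented_group S R) H" "k \<in> hom (presented_group S R) H"
    and "\<And>g. g \<in> S \<Longrightarrow> h (pres_class S R [(g, True)]) = k (pres_class S R [(g, True)])"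
    and "C \<in> carrier (presented_group S R)"
  shows "h C = k C"
proof -
  obtain w where w: "w \<in> words S" "C = pres_class S R w"
    using assms(5) by (elim presented_group_cases)
  have "word_eval H (\<lambda>g. h (pres_class S R [(g, True)])) w = word_eval H (\<lambda>g. k (pres_class S R [(g, True)])) w"
    using w(1) by (induction w) (auto simp: word_eval_def assms(4))
  then show ?thesis using hom_class_eq_word_eval assms(1-3) w by metis
qed


section \<open>The group of parenthesized braids\<close>

datatype pb_gen = Sig nat | Alpha nat

definition pb_gens :: "pb_gen set" where
  "pb_gens = {Sig i | i. i \<ge> 1} \<union> {Alpha i | i. i \<ge> 1}"

definition pos_word :: "'g list \<Rightarrow> 'g word" where
  "pos_word gs = map (\<lambda>g. (g, True)) gs"

inductive_set pb_pos_rels :: "(pb_gen list \<times> pb_gen list) set" where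
  "i \<ge> 1 \<Longrightarrow> j \<ge> i + 2 \<Longrightarrow> ([Sig i, Sig j], [Sig j, Sig i]) \<in> pb_pos_rels"
| "i \<ge> 1 \<Longrightarrow> j \<ge> i + 2 \<Longrightarrow> ([Sig i, Alpha j], [Alpha j, Sig i]) \<in> pb_pos_rels"
| "i \<ge> 1 \<Longrightarrow> j \<ge> i + 2 \<Longrightarrow> ([Alpha i, Alpha (j - 1)], [Alpha j, Alpha i]) \<in> pb_pos_rels"
| "i \<ge> 1 \<Longrightarrow> j \<ge> i + 2 \<Longrightarrow> ([Alpha i, Sig (j - 1)], [Sig j, Alpha i]) \<in> pb_pos_rels"
| "i \<ge> 1 \<Longrightarrow> ([Sig i, Sig (i + 1), Sig i], [Sig (i + 1), Sig i, Sig (i + 1)]) \<in> pb_pos_rels"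
| "i \<ge> 1 \<Longrightarrow> ([Sig (i + 1), Sig i, Alpha (i + 1)], [Alpha i, Sig i]) \<in> pb_pos_rels"
| "i \<ge> 1 \<Longrightarrow> ([Sig i, Sig (i + 1), Alpha i], [Alpha (i + 1), Sig i]) \<in> pb_pos_rels"

definition pb_rels :: "(pb_gen word \<times> pb_gen word) set" where
  "pb_rels = map_prod pos_word pos_word ` pb_pos_rels"

definition B_bullet :: "pb_gen word set monoid" where
  "B_bullet = presented_group pb_gens pb_rels"


section \<open>The free group and its automorphisms\<close>

definition pos_seqs :: "nat list set" where
  "pos_seqs = {s. s \<noteq> [] \<and> (\<forall>k \<in> set s. k \<ge> 1)}"

definition F_bullet :: "nat list word set monoid" where
  "F_bullet = free_group pos_seqs"

definition x_gen :: "nat list \<Rightarrow> nat list word set" where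
  "x_gen s = pres_class pos_seqs {} [(s, True)]"

definition F_hom :: "(nat list \<Rightarrow> nat list word set) \<Rightarrow> nat list word set \<Rightarrow> nat list word set" where
  "F_hom f = pres_hom pos_seqs {} F_bullet f"

text \<open>The images of the basis elements under \<open>\<psi>(\<sigma>\<^sub>i)\<close> and \<open>\<psi>(a\<^sub>i)\<close>; only the values on
  \<^term>\<open>pos_seqs\<close> matter.\<close>

fun sigma_img :: "nat \<Rightarrow> nat list \<Rightarrow> nat list word set" where
  "sigma_img i (j # s) =
    (if j = i then x_gen [i] \<otimes>\<^bsub>F_bullet\<^esub> x_gen ((i + 1) # s) \<otimes>\<^bsub>F_bullet\<^esub> inv\<^bsub>F_bullet\<^esub> (x_gen [i])
     else if j = i + 1 then x_gen (i # s)
     else x_gen (j # s))"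
| "sigma_img i [] = \<one>\<^bsub>F_bullet\<^esub>"

fun alpha_img :: "nat \<Rightarrow> nat list \<Rightarrow> nat list word set" where
  "alpha_img i (j # s) =
    (if j < i then x_gen (j # s)
     else if j > i then x_gen ((j + 1) # s)
     else (case s of
         [] \<Rightarrow> x_gen [i] \<otimes>\<^bsub>F_bullet\<^esub> x_gen [i + 1]
       | k # t \<Rightarrow> if k = 1 then x_gen (i # t) else x_gen ((i + 1) # (k - 1) # t)))"
| "alpha_img i [] = \<one>\<^bsub>F_bullet\<^esub>"

fun psi_gen :: "pb_gen \<Rightarrow> nat list word set \<Rightarrow> nat list word set" where
  "psi_gen (Sig i) = F_hom (sigma_img i)"
| "psi_gen (Alpha i) = F_hom (alpha_img i)"

text \<open>The product of \<^term>\<open>AutoGroup F_bullet\<close> is composition, so that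
  \<open>\<psi>(x y) = \<psi>(x) \<circ> \<psi>(y)\<close>.\<close>

definition psi :: "pb_gen word set \<Rightarrow> nat list word set \<Rightarrow> nat list word set" where
  "psi = pres_hom pb_gens pb_rels (AutoGroup F_bullet) psi_gen"

interpretation F: group F_bullet
  by (simp add: F_bullet_def group_free_group)

lemma x_gen_closed [simp]: "s \<in> pos_seqs \<Longrightarrow> x_gen s \<in> carrier F_bullet"
  by (simp add: x_gen_def F_bullet_def free_group_def)

lemma F_hom_hom: "f \<in> pos_seqs \<rightarrow> carrier F_bullet \<Longrightarrow> F_hom f \<in> hom F_bullet F_bullet"
  using F.pres_hom_hom [of f pos_seqs "{}"]
  by (simp add: F_hom_def F_bullet_def free_group_def)

lemma F_hom_gen: "f \<in> pos_seqs \<rightarrow> carrier F_bullet \<Longrightarrow> s \<in> pos_seqs \<Longrightarrow> F_hom f (x_gen s) = f s"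
  using F.pres_hom_generator [of f pos_seqs "{}"]
  by (simp add: F_hom_def x_gen_def)

lemma F_hom_ext: "F_hom f \<in> extensional (carrier F_bullet)"
  by (simp add: F_hom_def pres_hom_def F_bullet_def free_group_def)

lemma F_hom_unique:
  "\<lbrakk>h \<in> hom F_bullet F_bullet; k \<in> hom F_bullet F_bullet;
    \<And>s. s \<in> pos_seqs \<Longrightarrow> h (x_gen s) = k (x_gen s); c \<in> carrier F_bullet\<rbrakk> \<Longrightarrow> h c = k c"
  using pres_hom_unique [of F_bullet h pos_seqs "{}" k c]
  by (simp add: F_bullet_def free_group_def x_gen_def group_presented_group)

lemma pos_seqs_simps [simp]:
  "[] \<notin> pos_seqs"
  "j # s \<in> pos_seqs \<longleftrightarrow> Suc 0 \<le> j \<and> (\<forall>k \<in> set s. Suc 0 \<le> k)"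
  by (auto simp: pos_seqs_def)

lemma sigma_img_closed: "i \<ge> 1 \<Longrightarrow> sigma_img i \<in> pos_seqs \<rightarrow> carrier F_bullet"
proof
  fix s assume "i \<ge> 1" "s \<in> pos_seqs"
  then show "sigma_img i s \<in> carrier F_bullet"
    by (cases s) simp_all
qed

lemma alpha_img_closed: "i \<ge> 1 \<Longrightarrow> alpha_img i \<in> pos_seqs \<rightarrow> carrier F_bullet"
proof
  fix s assume "i \<ge> 1" "s \<in> pos_seqs"
  then show "alpha_img i s \<in> carrier F_bullet"
    by (cases s) (auto split: list.splits)
qed

lemma F_hom_mult:
  "\<lbrakk>f \<in> pos_seqs \<rightarrow> carrier F_bullet; a \<in> carrier F_bullet; b \<in> carrier F_bullet\<rbrakk>
    \<Longrightarrow> F_hom f (a \<otimes>\<^bsub>F_bullet\<^esub> b) = F_hom f a \<otimes>\<^bsub>F_bullet\<^esub> F_hom f b"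
  using F_hom_hom by (rule hom_mult)

lemma F_hom_inv:
  assumes "f \<in> pos_seqs \<rightarrow> carrier F_bullet" "a \<in> carrier F_bullet"
  shows "F_hom f (inv\<^bsub>F_bullet\<^esub> a) = inv\<^bsub>F_bullet\<^esub> (F_hom f a)"
proof -
  interpret group_hom F_bullet F_bullet "F_hom f"
    by unfold_locales (rule F_hom_hom [OF assms(1)])
  show ?thesis using assms(2) by (rule hom_inv)
qed

lemma F_hom_closed:
  "\<lbrakk>f \<in> pos_seqs \<rightarrow> carrier F_bullet; a \<in> carrier F_bullet\<rbrakk> \<Longrightarrow> F_hom f a \<in> carrier F_bullet"
  using F_hom_hom hom_in_carrier by metis

lemma F_hom_auto:
  assumes f: "f \<in> pos_seqs \<rightarrow> carrier F_bullet" and g: "g \<in> pos_seqs \<rightarrow> carrier F_bullet"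
    and fg: "\<And>s. s \<in> pos_seqs \<Longrightarrow> F_hom f (g s) = x_gen s"
    and gf: "\<And>s. s \<in> pos_seqs \<Longrightarrow> F_hom g (f s) = x_gen s"
  shows "F_hom f \<in> auto F_bullet"
proof -
  have id: "F_hom k (F_hom h c) = c"
    if k: "k \<in> pos_seqs \<rightarrow> carrier F_bullet" and h: "h \<in> pos_seqs \<rightarrow> carrier F_bullet"
      and kh: "\<And>s. s \<in> pos_seqs \<Longrightarrow> F_hom k (h s) = x_gen s"
      and c: "c \<in> carrier F_bullet" for k h c
    by (rule F_hom_unique [of "\<lambda>c. F_hom k (F_hom h c)" "\<lambda>c. c"])
       (use k h kh c in \<open>auto intro!: homI simp: F_hom_mult F_hom_closed F_hom_gen\<close>)
  have "bij_betw (F_hom f) (carrier F_bullet) (carrier F_bullet)"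
    by (rule bij_betw_byWitness [where f' = "F_hom g"])
       (auto simp: id [OF f g fg] id [OF g f gf] F_hom_closed f g)
  then show ?thesis
    by (simp add: auto_def Bij_def F_hom_hom f F_hom_ext)
qed

fun sigma_inv_img :: "nat \<Rightarrow> nat list \<Rightarrow> nat list word set" where
  "sigma_inv_img i (j # s) =
    (if j = i then x_gen ((i + 1) # s)
     else if j = i + 1 then inv\<^bsub>F_bullet\<^esub> (x_gen [i + 1]) \<otimes>\<^bsub>F_bullet\<^esub> x_gen (i # s) \<otimes>\<^bsub>F_bullet\<^esub> x_gen [i + 1]
     else x_gen (j # s))"
| "sigma_inv_img i [] = \<one>\<^bsub>F_bullet\<^esub>"

fun alpha_inv_img :: "nat \<Rightarrow> nat list \<Rightarrow> nat list word set" where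
  "alpha_inv_img i (j # s) =
    (if j < i then x_gen (j # s)
     else if j = i then x_gen (i # 1 # s)
     else if j > i + 1 then x_gen ((j - 1) # s)
     else (case s of
         [] \<Rightarrow> inv\<^bsub>F_bullet\<^esub> (x_gen [i, 1]) \<otimes>\<^bsub>F_bullet\<^esub> x_gen [i]
       | k # t \<Rightarrow> x_gen (i # (k + 1) # t)))"
| "alpha_inv_img i [] = \<one>\<^bsub>F_bullet\<^esub>"

lemma sigma_inv_img_closed: "i \<ge> 1 \<Longrightarrow> sigma_inv_img i \<in> pos_seqs \<rightarrow> carrier F_bullet"
proof
  fix s assume "i \<ge> 1" "s \<in> pos_seqs"
  then show "sigma_inv_img i s \<in> carrier F_bullet"
    by (cases s) simp_all
qed

lemma alpha_inv_img_closed: "i \<ge> 1 \<Longrightarrow> alpha_inv_img i \<in> pos_seqs \<rightarrow> carrier F_bullet"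
proof
  fix s assume "i \<ge> 1" "s \<in> pos_seqs"
  then show "alpha_inv_img i s \<in> carrier F_bullet"
    by (cases s) (auto split: list.splits)
qed

lemma F_cancel:
  "\<lbrakk>a \<in> carrier F_bullet; b \<in> carrier F_bullet\<rbrakk> \<Longrightarrow> inv\<^bsub>F_bullet\<^esub> a \<otimes>\<^bsub>F_bullet\<^esub> (a \<otimes>\<^bsub>F_bullet\<^esub> b) = b"
  "\<lbrakk>a \<in> carrier F_bullet; b \<in> carrier F_bullet\<rbrakk> \<Longrightarrow> a \<otimes>\<^bsub>F_bullet\<^esub> (inv\<^bsub>F_bullet\<^esub> a \<otimes>\<^bsub>F_bullet\<^esub> b) = b"
  by (simp_all add: F.m_assoc [symmetric])

lemmas F_hom_eval = F_hom_mult F_hom_inv F_hom_gen F.m_assoc F.inv_mult_group F_cancel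

lemma sigma_auto:
  assumes i: "i \<ge> 1"
  shows "psi_gen (Sig i) \<in> auto F_bullet"
  unfolding psi_gen.simps
proof (rule F_hom_auto [where g = "sigma_inv_img i"])
  note [simp] = sigma_img_closed sigma_inv_img_closed F_hom_eval
  show "sigma_img i \<in> pos_seqs \<rightarrow> carrier F_bullet" "sigma_inv_img i \<in> pos_seqs \<rightarrow> carrier F_bullet"
    using i by simp_all
  fix s assume "s \<in> pos_seqs"
  then show "F_hom (sigma_img i) (sigma_inv_img i s) = x_gen s"
    "F_hom (sigma_inv_img i) (sigma_img i s) = x_gen s"
    using i by (cases s; simp)+
qed

lemma alpha_auto:
  assumes i: "i \<ge> 1"
  shows "psi_gen (Alpha i) \<in> auto F_bullet"
  unfolding psi_gen.simps
proof (rule F_hom_auto [where g = "alpha_inv_img i"])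
  note [simp] = alpha_img_closed alpha_inv_img_closed F_hom_eval
  show "alpha_img i \<in> pos_seqs \<rightarrow> carrier F_bullet" "alpha_inv_img i \<in> pos_seqs \<rightarrow> carrier F_bullet"
    using i by simp_all
  fix s assume s: "s \<in> pos_seqs"
  then obtain j t where st: "s = j # t" by (cases s) auto
  show "F_hom (alpha_img i) (alpha_inv_img i s) = x_gen s"
    using s st i by (cases t) (auto simp: not_less not_le)
  show "F_hom (alpha_inv_img i) (alpha_img i s) = x_gen s"
    using s st i by (cases t) (auto simp: not_less not_le)
qed

lemma psi_gen_auto: "psi_gen \<in> pb_gens \<rightarrow> auto F_bullet"
  unfolding pb_gens_def using sigma_auto alpha_auto by blast

lemma AutoGroup_simps:
  "carrier (AutoGroup F_bullet) = auto F_bullet"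
  "g \<in> auto F_bullet \<Longrightarrow> f \<in> auto F_bullet \<Longrightarrow> c \<in> carrier F_bullet
    \<Longrightarrow> (g \<otimes>\<^bsub>AutoGroup F_bullet\<^esub> f) c = g (f c)"
  "c \<in> carrier F_bullet \<Longrightarrow> \<one>\<^bsub>AutoGroup F_bullet\<^esub> c = c"
  by (simp_all add: AutoGroup_def BijGroup_def auto_def compose_def)

lemma word_eval_psi_gen:
  assumes "set gs \<subseteq> pb_gens" "c \<in> carrier F_bullet"
  shows "word_eval (AutoGroup F_bullet) psi_gen (pos_word gs) c = foldr psi_gen gs c"
  using assms(1)
proof (induction gs)
  case Nil
  then show ?case using assms(2) by (simp add: word_eval_def pos_word_def AutoGroup_simps)
next
  case (Cons g gs)
  interpret A: group "AutoGroup F_bullet" by (rule F.AutoGroup)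
  have "pos_word gs \<in> words pb_gens" using Cons.prems by (induction gs) (auto simp: pos_word_def)
  then have "word_eval (AutoGroup F_bullet) psi_gen (pos_word gs) \<in> auto F_bullet"
    using A.word_eval_closed [of psi_gen pb_gens] psi_gen_auto by (simp add: AutoGroup_simps)
  moreover have "psi_gen g \<in> auto F_bullet" using Cons.prems psi_gen_auto by auto
  ultimately have "word_eval (AutoGroup F_bullet) psi_gen (pos_word (g # gs)) c =
      psi_gen g (word_eval (AutoGroup F_bullet) psi_gen (pos_word gs) c)"
    using assms(2) by (simp add: word_eval_def pos_word_def AutoGroup_simps)
  with Cons show ?case by simp
qed

lemma pos_rels_gens: "(us, vs) \<in> pb_pos_rels \<Longrightarrow> set us \<subseteq> pb_gens \<and> set vs \<subseteq> pb_gens"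
  by (induction rule: pb_pos_rels.induct) (auto simp: pb_gens_def)

lemma psi_pos_rels:
  "(us, vs) \<in> pb_pos_rels \<Longrightarrow> s \<in> pos_seqs \<Longrightarrow> foldr psi_gen us (x_gen s) = foldr psi_gen vs (x_gen s)"
proof -
  note [simp] = alpha_img_closed sigma_img_closed F_hom_eval
  assume "(us, vs) \<in> pb_pos_rels" and s: "s \<in> pos_seqs"
  obtain j t where [simp]: "s = j # t" using s by (cases s) auto
  show ?thesis
    using \<open>(us, vs) \<in> pb_pos_rels\<close> s
    by (cases rule: pb_pos_rels.cases; cases t) (auto simp: not_less not_le)
qed

lemma psi_rels:
  assumes "(u, v) \<in> pb_rels"
  shows "word_eval (AutoGroup F_bullet) psi_gen u = word_eval (AutoGroup F_bullet) psi_gen v"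
proof -
  obtain us vs where uv: "(us, vs) \<in> pb_pos_rels" "u = pos_word us" "v = pos_word vs"
    using assms by (auto simp: pb_rels_def)
  interpret A: group "AutoGroup F_bullet" by (rule F.AutoGroup)
  have auto: "word_eval (AutoGroup F_bullet) psi_gen (pos_word gs) \<in> auto F_bullet"
    if "set gs \<subseteq> pb_gens" for gs
  proof -
    have "pos_word gs \<in> words pb_gens" using that by (induction gs) (auto simp: pos_word_def)
    then show ?thesis
      using A.word_eval_closed [of psi_gen pb_gens] psi_gen_auto by (simp add: AutoGroup_simps)
  qed
  have us: "set us \<subseteq> pb_gens" and vs: "set vs \<subseteq> pb_gens" using pos_rels_gens uv by auto
  show ?thesis
    unfolding uv
  proof (rule extensionalityI)
    fix c assume "c \<in> carrier F_bullet"
    then show "word_eval (AutoGroup F_bullet) psi_gen (pos_word us) c =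
        word_eval (AutoGroup F_bullet) psi_gen (pos_word vs) c"
    proof (rule F_hom_unique [rotated -1])
      fix s assume "s \<in> pos_seqs"
      then show "word_eval (AutoGroup F_bullet) psi_gen (pos_word us) (x_gen s) =
          word_eval (AutoGroup F_bullet) psi_gen (pos_word vs) (x_gen s)"
        by (simp add: word_eval_psi_gen us vs psi_pos_rels [OF uv(1)])
    qed (use auto [OF us] auto [OF vs] in \<open>simp_all add: auto_def\<close>)
  qed (use auto [OF us] auto [OF vs] in \<open>simp_all add: auto_def Bij_def\<close>)
qed

theorem psi_hom: "psi \<in> hom B_bullet (AutoGroup F_bullet)"
  unfolding psi_def B_bullet_def
  by (rule group.pres_hom_hom [OF F.AutoGroup]) (simp_all add: psi_gen_auto psi_rels AutoGroup_simps)

theorem psi_generator: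
  "g \<in> pb_gens \<Longrightarrow> psi (pres_class pb_gens pb_rels [(g, True)]) = psi_gen g"
  unfolding psi_def
  by (rule group.pres_hom_generator [OF F.AutoGroup]) (simp_all add: psi_gen_auto psi_rels AutoGroup_simps)

end

theory Submission
  imports Defs "HOL-Algebra.Generated_Groups" "HOL-Algebra.Elementary_Groups"
    "HOL-Combinatorics.Transposition"
begin

text \<open>Every element of the group is a fraction \<open>A\<^sup>-\<^sup>1 b C\<close> with a braid \<open>b\<close> and products \<open>A\<close>, \<open>C\<close> of
  generators \<open>a\<^sub>i\<close>, since the \<open>a\<^sub>i\<close> can be moved past braids. Count, for each \<open>x\<^sub>j\<close>, the basis elements
  of length one in its image: braids do not change the count, and \<open>C\<close> ends in \<open>a\<^sub>j\<close> up to the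
  relations as soon as the count is at least two. So if \<open>b C\<close> and \<open>A\<close> act equally, their last
  letters cancel one by one, and it remains to see that a braid \<open>b\<close> acting trivially is trivial.
  This is the faithfulness of the Artin representation, and it follows by combing: a braid on
  the strands \<open>0, \<dots>, n\<close> is \<open>r h t\<close> with \<open>r = \<sigma>\<^sub>k \<dots> \<sigma>\<^sub>n\<^sub>-\<^sub>1\<close>, \<open>h\<close> a braid on the strands \<open>0, \<dots>, n - 1\<close>,
  and \<open>t\<close> dragging the last strand around the others. Then \<open>t\<close> maps \<open>x\<^sub>n\<close> to a conjugate \<open>g x\<^sub>n g\<^sup>-\<^sup>1\<close>, and
  sending \<open>x\<^sub>n\<close> to \<open>1\<close> and each other \<open>x\<^sub>k\<close> to the inverse of the \<open>k\<close>-th dragging generator maps \<open>g\<close> to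
  \<open>t\<^sup>-\<^sup>1\<close>. If the braid acts trivially, then \<open>r = 1\<close>, so \<open>t\<close> fixes \<open>x\<^sub>n\<close>, so \<open>g\<close> commutes with \<open>x\<^sub>n\<close>,
  so \<open>t = 1\<close>; one strand fewer remains.\<close>

section \<open>Combing in groups satisfying the braid relations\<close>

text \<open>Combing uses only the braid relations, so it is done for any family satisfying them; the
  subgroup of \<open>B_bullet\<close> generated by the \<sigma>'s then needs no presentation of its
  own.\<close>

locale braid_family = group +
  fixes s :: "nat \<Rightarrow> 'a"
  assumes s_closed [simp]: "s i \<in> carrier G"
    and s_comm: "Suc (Suc i) \<le> j \<Longrightarrow> s i \<otimes> s j = s j \<otimes> s i"
    and s_braid: "s i \<otimes> s (Suc i) \<otimes> s i = s (Suc i) \<otimes> s i \<otimes> s (Suc i)"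
begin

text \<open>The product \<open>s k\<close>, \<open>s (k + 1)\<close>, ..., \<open>s (n - 1)\<close>.
  For \<open>k\<close> from 0 to \<open>n\<close> these serve as coset representatives in the
  combing.\<close>

function ridge :: "nat \<Rightarrow> nat \<Rightarrow> 'a" where
  "ridge n k = (if k < n then s k \<otimes> ridge n (Suc k) else \<one>)"
  by auto
termination by (relation "measure (\<lambda>(n, k). n - k)") auto

declare ridge.simps [simp del]

lemma ridge_closed [simp]: "ridge n k \<in> carrier G"
  by (induction n k rule: ridge.induct) (subst ridge.simps, simp)

lemma ridge_top [simp]: "ridge n n = \<one>"
  by (simp add: ridge.simps)

lemma ridge_step: "k < n \<Longrightarrow> ridge n k = s k \<otimes> ridge n (Suc k)"
  by (subst ridge.simps) simp

lemma ridge_comm: "i + 2 \<le> k \<Longrightarrow> s i \<otimes> ridge n k = ridge n k \<otimes> s i"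
proof (induction n k rule: ridge.induct)
  case (1 n k)
  show ?case
  proof (cases "k < n")
    case True
    then have "s i \<otimes> ridge n k = s k \<otimes> (s i \<otimes> ridge n (Suc k))"
      using "1.prems" s_comm [of i k] by (simp add: ridge_step m_assoc [symmetric])
    also have "\<dots> = ridge n k \<otimes> s i"
      using True "1.prems" "1.IH" by (simp add: ridge_step m_assoc)
    finally show ?thesis .
  qed (simp add: ridge.simps)
qed

text \<open>At \<open>k = i\<close> the braid relation applies and the rest of the ridge commutes
  with \<open>s i\<close>; for \<open>k < i\<close> the first factor \<open>s k\<close> is far from
  \<open>s (Suc i)\<close>.\<close>

lemma ridge_shift: "k \<le> i \<Longrightarrow> Suc i < n \<Longrightarrow> s (Suc i) \<otimes> ridge n k = ridge n k \<otimes> s i"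
proof (induction n k rule: ridge.induct)
  case (1 n k)
  show ?case
  proof (cases "k = i")
    case True
    have "s (Suc i) \<otimes> ridge n i = s (Suc i) \<otimes> s i \<otimes> s (Suc i) \<otimes> ridge n (Suc (Suc i))"
      using "1.prems" by (simp add: ridge_step m_assoc)
    also have "\<dots> = s i \<otimes> s (Suc i) \<otimes> (s i \<otimes> ridge n (Suc (Suc i)))"
      by (simp add: s_braid [symmetric] m_assoc)
    also have "\<dots> = ridge n i \<otimes> s i"
      using "1.prems" by (simp add: ridge_step m_assoc ridge_comm)
    finally show ?thesis using True by simp
  next
    case False
    then have "s (Suc i) \<otimes> ridge n k = s k \<otimes> (s (Suc i) \<otimes> ridge n (Suc k))"
      using "1.prems" s_comm [of k "Suc i"] by (simp add: ridge_step m_assoc [symmetric])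
    also have "\<dots> = ridge n k \<otimes> s i"
      using False "1.prems" "1.IH" by (simp add: ridge_step m_assoc)
    finally show ?thesis .
  qed
qed

text \<open>The standard pure braid generator linking the strands \<open>k\<close> and
  \<open>n\<close>.\<close>

definition pure_gen :: "nat \<Rightarrow> nat \<Rightarrow> 'a" where
  "pure_gen n k = inv (ridge n (Suc k)) \<otimes> (s k \<otimes> s k) \<otimes> ridge n (Suc k)"

lemma pure_gen_closed [simp]: "pure_gen n k \<in> carrier G"
  by (simp add: pure_gen_def)

lemma cancel_left:
  "x \<in> carrier G \<Longrightarrow> y \<in> carrier G \<Longrightarrow> x \<otimes> (inv x \<otimes> y) = y"
  "x \<in> carrier G \<Longrightarrow> y \<in> carrier G \<Longrightarrow> inv x \<otimes> (x \<otimes> y) = y"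
  by (simp_all add: m_assoc [symmetric])

lemma ridge_pure_gen: "ridge n (Suc k) \<otimes> pure_gen n k = s k \<otimes> s k \<otimes> ridge n (Suc k)"
  by (simp add: pure_gen_def m_assoc cancel_left)

text \<open>Conjugates are computed by pushing \<open>r\<close> from left to right. With a ridge as
  \<open>r\<close>, identities between the \<open>pure_gen\<close>s reduce to identities between a
  few \<open>s i\<close>.\<close>

lemma intertwine_mult:
  assumes "r \<otimes> u = u' \<otimes> r" "r \<otimes> v = v' \<otimes> r"
    and [simp]: "r \<in> carrier G" "u \<in> carrier G" "v \<in> carrier G" "u' \<in> carrier G" "v' \<in> carrier G"
  shows "r \<otimes> (u \<otimes> v) = u' \<otimes> v' \<otimes> r"
proof -
  have "r \<otimes> (u \<otimes> v) = u' \<otimes> (r \<otimes> v)" by (simp add: m_assoc [symmetric] assms(1))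
  then show ?thesis by (simp add: assms(2) m_assoc)
qed

lemma ridge_pure_gen':
  assumes "Suc k < n"
  shows "ridge n (Suc (Suc k)) \<otimes> pure_gen n k =
    inv (s (Suc k)) \<otimes> (s k \<otimes> s k) \<otimes> s (Suc k) \<otimes> ridge n (Suc (Suc k))"
proof -
  have "s (Suc k) \<otimes> (ridge n (Suc (Suc k)) \<otimes> pure_gen n k) =
      s k \<otimes> s k \<otimes> (s (Suc k) \<otimes> ridge n (Suc (Suc k)))"
    using ridge_pure_gen [of n k] assms by (simp add: ridge_step m_assoc)
  then have "inv (s (Suc k)) \<otimes> (s (Suc k) \<otimes> (ridge n (Suc (Suc k)) \<otimes> pure_gen n k)) =
      inv (s (Suc k)) \<otimes> (s k \<otimes> s k \<otimes> (s (Suc k) \<otimes> ridge n (Suc (Suc k))))"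
    by simp
  then show ?thesis by (simp add: cancel_left m_assoc)
qed

text \<open>Write a = \<open>s k\<close> and b = \<open>s (Suc k)\<close>. Pushing through
  \<open>ridge n (Suc (Suc k))\<close>, which commutes with a, turns the two generators into b^-1 a
  a b and b b, and leaves the identity b^-1 a a b a = a b b.\<close>

lemma pure_gen_Suc:
  assumes "Suc k < n"
  shows "pure_gen n k \<otimes> s k = s k \<otimes> pure_gen n (Suc k)"
proof -
  let ?R = "ridge n (Suc (Suc k))" and ?a = "s k" and ?b = "s (Suc k)"
  have "?R \<otimes> (pure_gen n k \<otimes> ?a) = inv ?b \<otimes> (?a \<otimes> ?a) \<otimes> ?b \<otimes> ?a \<otimes> ?R"
    using assms by (intro intertwine_mult) (simp_all add: ridge_pure_gen' ridge_comm)
  moreover have "?R \<otimes> (?a \<otimes> pure_gen n (Suc k)) = ?a \<otimes> (?b \<otimes> ?b) \<otimes> ?R"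
    by (intro intertwine_mult) (simp_all add: ridge_pure_gen ridge_comm)
  moreover have "inv ?b \<otimes> (?a \<otimes> ?a) \<otimes> ?b \<otimes> ?a = ?a \<otimes> (?b \<otimes> ?b)"
  proof -
    have "?a \<otimes> ?a \<otimes> ?b \<otimes> ?a = ?a \<otimes> (?a \<otimes> ?b \<otimes> ?a)" by (simp add: m_assoc)
    also have "\<dots> = ?a \<otimes> ?b \<otimes> ?a \<otimes> ?b" by (subst s_braid) (simp add: m_assoc)
    also have "\<dots> = ?b \<otimes> (?a \<otimes> (?b \<otimes> ?b))" by (subst s_braid) (simp add: m_assoc)
    finally show ?thesis by (simp add: cancel_left m_assoc)
  qed
  ultimately have "?R \<otimes> (pure_gen n k \<otimes> ?a) = ?R \<otimes> (?a \<otimes> pure_gen n (Suc k))" by simp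
  then show ?thesis by simp
qed

text \<open>After the same push the product becomes b a a b, the full twist on three strands divided
  by a a, which commutes with a.\<close>

lemma pure_gen_pair_comm:
  assumes "Suc k < n"
  shows "s k \<otimes> (pure_gen n (Suc k) \<otimes> pure_gen n k) = pure_gen n (Suc k) \<otimes> pure_gen n k \<otimes> s k"
proof -
  let ?R = "ridge n (Suc (Suc k))" and ?a = "s k" and ?b = "s (Suc k)"
  let ?c = "?b \<otimes> ?b \<otimes> (inv ?b \<otimes> (?a \<otimes> ?a) \<otimes> ?b)"
  have c: "?R \<otimes> (pure_gen n (Suc k) \<otimes> pure_gen n k) = ?c \<otimes> ?R"
    by (intro intertwine_mult ridge_pure_gen' ridge_pure_gen assms) simp_all
  have "?R \<otimes> (?a \<otimes> (pure_gen n (Suc k) \<otimes> pure_gen n k)) = ?a \<otimes> ?c \<otimes> ?R"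
    by (rule intertwine_mult) (simp_all add: c ridge_comm)
  moreover have "?R \<otimes> (pure_gen n (Suc k) \<otimes> pure_gen n k \<otimes> ?a) = ?c \<otimes> ?a \<otimes> ?R"
    by (rule intertwine_mult) (simp_all add: c ridge_comm)
  moreover have "?a \<otimes> ?c = ?c \<otimes> ?a"
  proof -
    have "?c = ?b \<otimes> ?a \<otimes> ?a \<otimes> ?b" by (simp add: cancel_left m_assoc)
    then have "?a \<otimes> ?c = ?a \<otimes> ?b \<otimes> ?a \<otimes> ?a \<otimes> ?b" by (simp add: m_assoc)
    also have "\<dots> = ?b \<otimes> ?a \<otimes> (?b \<otimes> ?a \<otimes> ?b)" by (subst s_braid) (simp add: m_assoc)
    also have "\<dots> = ?b \<otimes> ?a \<otimes> ?a \<otimes> ?b \<otimes> ?a" by (subst s_braid [symmetric]) (simp add: m_assoc)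
    also have "\<dots> = ?c \<otimes> ?a" by (simp add: cancel_left m_assoc)
    finally show ?thesis .
  qed
  ultimately have "?R \<otimes> (?a \<otimes> (pure_gen n (Suc k) \<otimes> pure_gen n k)) =
      ?R \<otimes> (pure_gen n (Suc k) \<otimes> pure_gen n k \<otimes> ?a)" by simp
  then show ?thesis by simp
qed

lemma pure_gen_comm:
  assumes "i + 2 \<le> k \<or> k < i \<and> Suc i < n"
  shows "s i \<otimes> pure_gen n k = pure_gen n k \<otimes> s i"
proof -
  \<comment> \<open>Past the ridge, \<open>s i\<close> keeps its index if
    \<open>i + 2 \<le> k\<close> and becomes \<open>s (Suc i)\<close> if \<open>k < i\<close>;
    either way it is far from \<open>s k\<close>.\<close>
  let ?R = "ridge n (Suc k)" and ?j = "if k < i then Suc i else i"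
  have j: "?R \<otimes> s i = s ?j \<otimes> ?R"
    using assms by (auto simp: ridge_comm ridge_shift)
  have "?R \<otimes> (s i \<otimes> pure_gen n k) = s ?j \<otimes> (s k \<otimes> s k) \<otimes> ?R"
    by (intro intertwine_mult j) (simp_all add: ridge_pure_gen)
  moreover have "?R \<otimes> (pure_gen n k \<otimes> s i) = s k \<otimes> s k \<otimes> s ?j \<otimes> ?R"
    by (intro intertwine_mult j) (simp_all add: ridge_pure_gen)
  moreover have "s ?j \<otimes> s k = s k \<otimes> s ?j"
    using assms s_comm [of i k] s_comm [of k "Suc i"] by auto
  then have "s ?j \<otimes> (s k \<otimes> s k) = s k \<otimes> s k \<otimes> s ?j"
    by (metis m_assoc s_closed)
  ultimately have "?R \<otimes> (s i \<otimes> pure_gen n k) = ?R \<otimes> (pure_gen n k \<otimes> s i)" by simp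
  then show ?thesis by simp
qed

section \<open>Normal forms by combing\<close>

lemma generate_left_induct:
  assumes "g \<in> generate G S" "S \<subseteq> carrier G"
    and "\<And>x z. x \<in> S \<Longrightarrow> z \<in> Z \<Longrightarrow> x \<otimes> z \<in> Z" "\<And>x z. x \<in> S \<Longrightarrow> z \<in> Z \<Longrightarrow> inv x \<otimes> z \<in> Z"
    and "Z \<subseteq> carrier G" "z \<in> Z"
  shows "g \<otimes> z \<in> Z"
  using assms(1,6)
proof (induction arbitrary: z)
  case (eng h1 h2)
  then have "h1 \<in> carrier G" "h2 \<in> carrier G" using generate_in_carrier assms(2) by auto
  with eng assms(5) show ?case by (auto simp: m_assoc)
qed (use assms in auto)

text \<open>The products of this shape are stable under left multiplication by each
  \<open>s i\<close> with \<open>i < n\<close> and by its inverse. \<open>K\<close> is kept abstract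
  so that \<open>drags n\<close> can be inserted, without knowing that the \<open>pure_gen\<close>s
  generate it.\<close>

lemma combing:
  assumes K: "subgroup K G" and kK: "\<And>k. k < n \<Longrightarrow> pure_gen n k \<in> K"
    and norm: "\<And>h t. h \<in> generate G (s ` {i. Suc i < n}) \<Longrightarrow> t \<in> K \<Longrightarrow> inv h \<otimes> t \<otimes> h \<in> K"
    and g: "g \<in> generate G (s ` {..<n})"
  obtains k h t where "k \<le> n" "h \<in> generate G (s ` {i. Suc i < n})" "t \<in> K" "g = ridge n k \<otimes> (h \<otimes> t)"
proof -
  let ?H = "generate G (s ` {i. Suc i < n})"
  have H: "subgroup ?H G" by (rule generate_is_subgroup) auto
  define P where "P = {h \<otimes> t | h t. h \<in> ?H \<and> t \<in> K}"
  define Z where "Z = {ridge n k \<otimes> p | k p. k \<le> n \<and> p \<in> P}"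
  have [simp]: "h \<in> ?H \<Longrightarrow> h \<in> carrier G" "t \<in> K \<Longrightarrow> t \<in> carrier G" for h t
    using subgroup.mem_carrier H K by metis+
  have [simp]: "p \<in> P \<Longrightarrow> p \<in> carrier G" for p by (auto simp: P_def)
  have hP: "h \<otimes> p \<in> P" if "h \<in> ?H" "p \<in> P" for h p
  proof -
    from that obtain h' t where p: "p = h' \<otimes> t" "h' \<in> ?H" "t \<in> K" by (auto simp: P_def)
    then have "h \<otimes> p = (h \<otimes> h') \<otimes> t" using that by (simp add: m_assoc)
    then show ?thesis using p that subgroup.m_closed [OF H] by (auto simp: P_def)
  qed
  have tP: "t \<otimes> p \<in> P" if "t \<in> K" "p \<in> P" for t p
  proof -
    from that obtain h t' where p: "p = h \<otimes> t'" "h \<in> ?H" "t' \<in> K" by (auto simp: P_def)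
    then have "t \<otimes> p = h \<otimes> ((inv h \<otimes> t \<otimes> h) \<otimes> t')"
      using that by (simp add: m_assoc cancel_left)
    moreover have "(inv h \<otimes> t \<otimes> h) \<otimes> t' \<in> K"
      using p that subgroup.m_closed [OF K] norm by simp
    ultimately show ?thesis using p(2) unfolding P_def by blast
  qed
  have sH: "s i \<in> ?H" "inv (s i) \<in> ?H" if "Suc i < n" for i
    using that by (auto intro: generate.incl generate.inv)
  have ZI: "ridge n k \<otimes> p \<in> Z" if "k \<le> n" "p \<in> P" for k p
    using that by (auto simp: Z_def)
  have swap: "inv x \<otimes> y = y \<otimes> inv z"
    if "x \<otimes> y = y \<otimes> z" "x \<in> carrier G" "y \<in> carrier G" "z \<in> carrier G" for x y z
    using that by (metis cancel_left(2) inv_closed m_assoc m_closed r_inv r_one)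
  have move: "s i \<otimes> z \<in> Z \<and> inv (s i) \<otimes> z \<in> Z" if "i < n" "z \<in> Z" for i z
  proof -
    from \<open>z \<in> Z\<close> obtain k p where z: "z = ridge n k \<otimes> p" "k \<le> n" "p \<in> P" by (auto simp: Z_def)
    have pass: ?thesis if "s i \<otimes> ridge n k = ridge n k \<otimes> s j" "Suc j < n" for j
    proof -
      have "s i \<otimes> z = ridge n k \<otimes> (s j \<otimes> p)" "inv (s i) \<otimes> z = ridge n k \<otimes> (inv (s j) \<otimes> p)"
        using z that(1) swap [OF that(1)] by (simp_all add: m_assoc [symmetric])
      then show ?thesis using that z by (auto intro!: ZI hP sH)
    qed
    \<comment> \<open>The letter may lie far below the start of the ridge (it passes unchanged),
      just below (the ridge grows), at the start (the ridge shrinks), or above (it passes with its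
      index lowered). In the two middle cases either the letter or its inverse leaves behind a
      \<open>pure_gen n i\<close> or its inverse, absorbed by \<open>tP\<close>.\<close>
    consider "i + 2 \<le> k" | "k = Suc i" | "k = i" | j where "i = Suc j" "k \<le> j"
      by (metis Suc_1 add_Suc_right add.right_neutral One_nat_def Suc_leI le_antisym
          less_Suc_eq_le not_less not_less_eq_eq Suc_le_D nat_less_le)
    then show ?thesis
    proof cases
      case 1
      then show ?thesis using z by (intro pass [of i] ridge_comm) auto
    next
      case 2
      have step: "ridge n i = s i \<otimes> ridge n k" using 2 \<open>i < n\<close> by (simp add: ridge_step)
      have "ridge n k = inv (s i) \<otimes> ridge n i" by (simp add: step cancel_left)
      moreover have "s i \<otimes> ridge n i = ridge n k \<otimes> pure_gen n i"
        using ridge_pure_gen [of n i] 2 step by (simp add: m_assoc)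
      ultimately have "inv (s i) \<otimes> ridge n k = ridge n i \<otimes> inv (pure_gen n i)"
        by (metis inv_closed inv_solve_left inv_solve_right m_assoc m_closed
            pure_gen_closed ridge_closed s_closed)
      then have "inv (s i) \<otimes> z = ridge n i \<otimes> (inv (pure_gen n i) \<otimes> p)"
        using z by (simp add: m_assoc [symmetric])
      moreover have "s i \<otimes> z = ridge n i \<otimes> p" using z step by (simp add: m_assoc)
      ultimately show ?thesis
        using z \<open>i < n\<close> kK subgroup.m_inv_closed [OF K] by (auto intro!: ZI tP)
    next
      case 3
      have step: "ridge n i = s i \<otimes> ridge n (Suc i)" using \<open>i < n\<close> by (simp add: ridge_step)
      have "s i \<otimes> z = ridge n (Suc i) \<otimes> (pure_gen n i \<otimes> p)"
        using z 3 step ridge_pure_gen [of n i] by (simp add: m_assoc [symmetric])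
      moreover have "inv (s i) \<otimes> z = ridge n (Suc i) \<otimes> p"
        using z 3 step by (simp add: m_assoc cancel_left)
      ultimately show ?thesis using z \<open>i < n\<close> kK by (auto intro!: ZI tP)
    next
      case 4
      then show ?thesis using \<open>i < n\<close> by (intro pass [of j]) (auto simp: ridge_shift)
    qed
  qed
  have "\<one> \<in> P"
    using subgroup.one_closed [OF H] subgroup.one_closed [OF K] by (force simp: P_def)
  then have "\<one> \<in> Z" using ZI [of n \<one>] by simp
  have "Z \<subseteq> carrier G" by (auto simp: Z_def)
  then have "g \<otimes> \<one> \<in> Z"
    using g move \<open>\<one> \<in> Z\<close> by (intro generate_left_induct [OF g]) auto
  moreover have "g \<in> carrier G" using g by (rule generate_in_carrier [rotated]) auto
  ultimately have "g \<in> Z" by simp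
  then show thesis using that by (auto simp: Z_def P_def)
qed

end

lemma (in group) conj_inv_eqI:
  assumes "x \<otimes> y = z \<otimes> x" and [simp]: "x \<in> carrier G" "y \<in> carrier G" "z \<in> carrier G"
  shows "x \<otimes> inv y \<otimes> inv x = inv z"
proof -
  have "inv z = inv (x \<otimes> y \<otimes> inv x)" by (simp add: assms(1) m_assoc)
  then show ?thesis by (simp add: inv_mult_group m_assoc)
qed

context braid_family
begin

text \<open>This and the next lemma are the formulas of \<open>sigma_img\<close> with each
  \<open>x1 k\<close> replaced by the inverse of \<open>pure_gen n k\<close>; they make
  \<open>eta\<close> equivariant.\<close>

lemma pure_gen_conj_Suc:
  "Suc k < n \<Longrightarrow> s k \<otimes> inv (pure_gen n (Suc k)) \<otimes> inv (s k) = inv (pure_gen n k)"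
  by (rule conj_inv_eqI) (simp_all add: pure_gen_Suc)

lemma pure_gen_conj_same:
  assumes "Suc k < n"
  shows "s k \<otimes> inv (pure_gen n k) \<otimes> inv (s k) =
    inv (pure_gen n k) \<otimes> inv (pure_gen n (Suc k)) \<otimes> pure_gen n k"
proof -
  let ?z = "inv (pure_gen n k) \<otimes> (pure_gen n (Suc k) \<otimes> pure_gen n k)"
  have "pure_gen n k \<otimes> (s k \<otimes> pure_gen n k) = s k \<otimes> (pure_gen n (Suc k) \<otimes> pure_gen n k)"
    using pure_gen_Suc [OF assms] by (simp add: m_assoc [symmetric])
  then have "pure_gen n k \<otimes> (s k \<otimes> pure_gen n k) = pure_gen n k \<otimes> (?z \<otimes> s k)"
    by (simp add: pure_gen_pair_comm [OF assms] m_assoc cancel_left)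
  then have "s k \<otimes> inv (pure_gen n k) \<otimes> inv (s k) = inv ?z"
    by (intro conj_inv_eqI) simp_all
  then show ?thesis by (simp add: inv_mult_group m_assoc)
qed

end

section \<open>The action on the free group\<close>

text \<open>Unlike \<open>F_hom\<close>, this allows any target group: the integers, a lamplighter
  group and \<open>B_bullet\<close> will occur.\<close>

definition F_ext :: "('h, 'm) monoid_scheme \<Rightarrow> (nat list \<Rightarrow> 'h) \<Rightarrow> nat list word set \<Rightarrow> 'h" where
  "F_ext H f = pres_hom pos_seqs {} H f"

lemma (in group) F_ext_hom: "f \<in> pos_seqs \<rightarrow> carrier G \<Longrightarrow> F_ext G f \<in> hom F_bullet G"
  using pres_hom_hom [of f pos_seqs "{}"] by (simp add: F_ext_def F_bullet_def free_group_def)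

lemma (in group) F_ext_gen:
  "f \<in> pos_seqs \<rightarrow> carrier G \<Longrightarrow> t \<in> pos_seqs \<Longrightarrow> F_ext G f (x_gen t) = f t"
  using pres_hom_generator [of f pos_seqs "{}"] by (simp add: F_ext_def x_gen_def)

lemma (in group) F_hom_eqI:
  "\<lbrakk>h \<in> hom F_bullet G; k \<in> hom F_bullet G;
    \<And>t. t \<in> pos_seqs \<Longrightarrow> h (x_gen t) = k (x_gen t); c \<in> carrier F_bullet\<rbrakk> \<Longrightarrow> h c = k c"
  using pres_hom_unique [of G h pos_seqs "{}" k c] is_group
  by (simp add: F_bullet_def free_group_def x_gen_def)

text \<open>The unrestricted wreath product of the group of order two by \<open>G\<close>: the second component is
  the set of lit lamps, as a predicate that is false outside the carrier.\<close>

definition lamplighter :: "('a, 'm) monoid_scheme \<Rightarrow> ('a \<times> ('a \<Rightarrow> bool)) monoid" where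
  "lamplighter G =
    \<lparr>carrier = {(h, p). h \<in> carrier G \<and> (\<forall>z. p z \<longrightarrow> z \<in> carrier G)},
     mult = \<lambda>(h, p) (k, q). (h \<otimes>\<^bsub>G\<^esub> k, \<lambda>z. z \<in> carrier G \<and> (p z \<noteq> q (inv\<^bsub>G\<^esub> h \<otimes>\<^bsub>G\<^esub> z))),
     one = (\<one>\<^bsub>G\<^esub>, \<lambda>z. False)\<rparr>"

lemma (in group) group_lamplighter: "group (lamplighter G)"
proof (rule groupI)
  fix x assume "x \<in> carrier (lamplighter G)"
  then show "\<exists>y\<in>carrier (lamplighter G). y \<otimes>\<^bsub>lamplighter G\<^esub> x = \<one>\<^bsub>lamplighter G\<^esub>"
    by (intro bexI [where x = "(inv (fst x), \<lambda>z. z \<in> carrier G \<and> snd x (fst x \<otimes> z))"])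
       (auto simp: lamplighter_def)
qed (auto simp: lamplighter_def m_assoc inv_mult_group fun_eq_iff)

text \<open>In the lamplighter group, the conjugate of the lamp at \<open>\<one>\<close> by \<open>g\<close> is the lamp at the
  position of \<open>g\<close>.\<close>

lemma (in group) F_centralizer:
  assumes e: "e \<in> hom F_bullet G" "e (x_gen t) = \<one>" and t: "t \<in> pos_seqs"
    and g: "g \<in> carrier F_bullet" "g \<otimes>\<^bsub>F_bullet\<^esub> x_gen t = x_gen t \<otimes>\<^bsub>F_bullet\<^esub> g"
  shows "e g = \<one>"
proof -
  interpret W: group "lamplighter G" by (rule group_lamplighter)
  \<comment> \<open>Only \<open>x_gen t\<close> lights a lamp, and since \<open>e\<close> kills it,
    its image is a lamp without motion.\<close>
  define f where "f u = (e (x_gen u), \<lambda>z. u = t \<and> z = \<one>)" for u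
  have f: "f \<in> pos_seqs \<rightarrow> carrier (lamplighter G)"
    using hom_in_carrier [OF e(1)] by (auto simp: f_def lamplighter_def)
  let ?\<theta> = "F_ext (lamplighter G) f"
  note \<theta> = W.F_ext_hom [OF f]
  have fst: "fst (?\<theta> c) = e c" if "c \<in> carrier F_bullet" for c
  proof (rule F_hom_eqI [OF _ e(1) _ that, of "\<lambda>c. fst (?\<theta> c)"])
    have "fst \<in> hom (lamplighter G) G" by (auto intro!: homI simp: lamplighter_def)
    then show "(\<lambda>c. fst (?\<theta> c)) \<in> hom F_bullet G"
      using \<theta> by (auto simp: hom_def Pi_iff)
  qed (simp add: W.F_ext_gen [OF f] f_def)
  obtain p where p: "?\<theta> g = (e g, p)" using fst [OF g(1)] by (metis prod.collapse)
  have eg: "e g \<in> carrier G" using hom_in_carrier [OF e(1) g(1)] .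
  have "?\<theta> g \<otimes>\<^bsub>lamplighter G\<^esub> ?\<theta> (x_gen t) = ?\<theta> (x_gen t) \<otimes>\<^bsub>lamplighter G\<^esub> ?\<theta> g"
    using g t by (simp add: hom_mult [OF \<theta>, symmetric])
  moreover have "?\<theta> (x_gen t) = (\<one>, \<lambda>z. z = \<one>)"
    using e(2) by (simp add: W.F_ext_gen [OF f t] f_def)
  ultimately have "(e g, p) \<otimes>\<^bsub>lamplighter G\<^esub> (\<one>, \<lambda>z. z = \<one>) = (\<one>, \<lambda>z. z = \<one>) \<otimes>\<^bsub>lamplighter G\<^esub> (e g, p)"
    by (simp only: p)
  \<comment> \<open>Compare the lamps at \<open>\<one>\<close>: one side toggles
    \<open>p \<one>\<close> exactly if \<open>e g\<close> is trivial, the other always does.\<close>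
  then have "(\<one> \<in> carrier G \<and> p \<one> \<noteq> (inv (e g) \<otimes> \<one> = \<one>)) =
      (\<one> \<in> carrier G \<and> (\<one> = \<one>) \<noteq> p (inv \<one> \<otimes> \<one>))"
    unfolding lamplighter_def by (simp only: monoid.simps prod.case prod.inject) metis
  then show ?thesis using eg by (cases "p \<one>") auto
qed

section \<open>The generators with shifted indices and their action\<close>

interpretation B: group B_bullet
  by (simp add: B_bullet_def group_presented_group)

text \<open>All indices in \<open>sig\<close>, \<open>alp\<close> and \<open>x1\<close> are shifted down by one, so that they range over all
  natural numbers.\<close>

definition sig :: "nat \<Rightarrow> pb_gen word set" where
  "sig i = pres_class pb_gens pb_rels [(Sig (Suc i), True)]"

definition alp :: "nat \<Rightarrow> pb_gen word set" where
  "alp i = pres_class pb_gens pb_rels [(Alpha (Suc i), True)]"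

abbreviation x1 :: "nat \<Rightarrow> nat list word set" where
  "x1 j \<equiv> x_gen [Suc j]"

lemma pb_gens_Suc [simp]: "Sig (Suc i) \<in> pb_gens" "Alpha (Suc i) \<in> pb_gens"
  by (auto simp: pb_gens_def)

lemma sig_closed [simp]: "sig i \<in> carrier B_bullet"
  and alp_closed [simp]: "alp i \<in> carrier B_bullet"
  by (simp_all add: sig_def alp_def B_bullet_def)

lemma pos_rel_eq:
  assumes "(us, vs) \<in> pb_pos_rels"
  shows "pres_class pb_gens pb_rels (pos_word us) = pres_class pb_gens pb_rels (pos_word vs)"
proof -
  have "(pos_word us, pos_word vs) \<in> pb_rels" using assms by (force simp: pb_rels_def)
  moreover have "set ws \<subseteq> pb_gens \<Longrightarrow> pos_word ws \<in> words pb_gens" for ws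
    by (induction ws) (auto simp: pos_word_def)
  then have "pos_word us \<in> words pb_gens" "pos_word vs \<in> words pb_gens"
    using pos_rels_gens [OF assms] by auto
  ultimately show ?thesis by (simp add: pres_class_eq_iff pres_cong.rel)
qed

lemma B_relations:
  "Suc (Suc i) \<le> j \<Longrightarrow> sig i \<otimes>\<^bsub>B_bullet\<^esub> sig j = sig j \<otimes>\<^bsub>B_bullet\<^esub> sig i"
  "Suc (Suc i) \<le> j \<Longrightarrow> sig i \<otimes>\<^bsub>B_bullet\<^esub> alp j = alp j \<otimes>\<^bsub>B_bullet\<^esub> sig i"
  "i < j \<Longrightarrow> alp i \<otimes>\<^bsub>B_bullet\<^esub> alp j = alp (Suc j) \<otimes>\<^bsub>B_bullet\<^esub> alp i"
  "i < j \<Longrightarrow> alp i \<otimes>\<^bsub>B_bullet\<^esub> sig j = sig (Suc j) \<otimes>\<^bsub>B_bullet\<^esub> alp i"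
  "sig i \<otimes>\<^bsub>B_bullet\<^esub> sig (Suc i) \<otimes>\<^bsub>B_bullet\<^esub> sig i =
    sig (Suc i) \<otimes>\<^bsub>B_bullet\<^esub> sig i \<otimes>\<^bsub>B_bullet\<^esub> sig (Suc i)"
  "sig (Suc i) \<otimes>\<^bsub>B_bullet\<^esub> sig i \<otimes>\<^bsub>B_bullet\<^esub> alp (Suc i) = alp i \<otimes>\<^bsub>B_bullet\<^esub> sig i"
  "sig i \<otimes>\<^bsub>B_bullet\<^esub> sig (Suc i) \<otimes>\<^bsub>B_bullet\<^esub> alp i = alp (Suc i) \<otimes>\<^bsub>B_bullet\<^esub> sig i"
  subgoal
    using pos_rel_eq [OF pb_pos_rels.intros(1) [of "Suc i" "Suc j"]]
    by (simp add: sig_def alp_def B_bullet_def pos_word_def)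
  subgoal
    using pos_rel_eq [OF pb_pos_rels.intros(2) [of "Suc i" "Suc j"]]
    by (simp add: sig_def alp_def B_bullet_def pos_word_def)
  subgoal
    using pos_rel_eq [OF pb_pos_rels.intros(3) [of "Suc i" "Suc (Suc j)"]]
    by (simp add: sig_def alp_def B_bullet_def pos_word_def)
  subgoal
    using pos_rel_eq [OF pb_pos_rels.intros(4) [of "Suc i" "Suc (Suc j)"]]
    by (simp add: sig_def alp_def B_bullet_def pos_word_def)
  subgoal
    using pos_rel_eq [OF pb_pos_rels.intros(5) [of "Suc i"]]
    by (simp add: sig_def alp_def B_bullet_def pos_word_def)
  subgoal
    using pos_rel_eq [OF pb_pos_rels.intros(6) [of "Suc i"]]
    by (simp add: sig_def alp_def B_bullet_def pos_word_def)
  subgoal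
    using pos_rel_eq [OF pb_pos_rels.intros(7) [of "Suc i"]]
    by (simp add: sig_def alp_def B_bullet_def pos_word_def)
  done

interpretation braid: braid_family B_bullet sig
  by (intro braid_family.intro braid_family_axioms.intro B.is_group sig_closed B_relations)

lemma psi_auto: "g \<in> carrier B_bullet \<Longrightarrow> psi g \<in> auto F_bullet"
  using hom_in_carrier [OF psi_hom] by (simp add: AutoGroup_simps)

lemma psi_F_hom: "g \<in> carrier B_bullet \<Longrightarrow> psi g \<in> hom F_bullet F_bullet"
  using psi_auto unfolding auto_def by blast

lemma psi_closed [simp]:
  "g \<in> carrier B_bullet \<Longrightarrow> c \<in> carrier F_bullet \<Longrightarrow> psi g c \<in> carrier F_bullet"
  by (rule hom_in_carrier [OF psi_F_hom])

lemma psi_F_mult [simp]: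
  "g \<in> carrier B_bullet \<Longrightarrow> c \<in> carrier F_bullet \<Longrightarrow> d \<in> carrier F_bullet \<Longrightarrow>
    psi g (c \<otimes>\<^bsub>F_bullet\<^esub> d) = psi g c \<otimes>\<^bsub>F_bullet\<^esub> psi g d"
  by (rule hom_mult [OF psi_F_hom])

lemma psi_F_inv [simp]:
  assumes "g \<in> carrier B_bullet" "c \<in> carrier F_bullet"
  shows "psi g (inv\<^bsub>F_bullet\<^esub> c) = inv\<^bsub>F_bullet\<^esub> (psi g c)"
proof -
  interpret group_hom F_bullet F_bullet "psi g"
    by unfold_locales (rule psi_F_hom [OF assms(1)])
  show ?thesis using assms(2) by (rule hom_inv)
qed

lemma psi_mult [simp]:
  assumes "g \<in> carrier B_bullet" "h \<in> carrier B_bullet" "c \<in> carrier F_bullet"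
  shows "psi (g \<otimes>\<^bsub>B_bullet\<^esub> h) c = psi g (psi h c)"
  using hom_mult [OF psi_hom assms(1,2)] assms psi_auto by (simp add: AutoGroup_simps)

lemma psi_one [simp]: "c \<in> carrier F_bullet \<Longrightarrow> psi \<one>\<^bsub>B_bullet\<^esub> c = c"
proof -
  interpret group_hom B_bullet "AutoGroup F_bullet" psi
    by (intro group_hom.intro group_hom_axioms.intro B.is_group F.AutoGroup psi_hom)
  show "c \<in> carrier F_bullet \<Longrightarrow> psi \<one>\<^bsub>B_bullet\<^esub> c = c"
    by (simp add: AutoGroup_simps)
qed

lemma psi_inv [simp]:
  assumes "g \<in> carrier B_bullet" "c \<in> carrier F_bullet"
  shows "psi (inv\<^bsub>B_bullet\<^esub> g) (psi g c) = c" "psi g (psi (inv\<^bsub>B_bullet\<^esub> g) c) = c"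
  using assms by (simp_all add: psi_mult [symmetric] del: psi_mult)

lemma psi_sig [simp]: "t \<in> pos_seqs \<Longrightarrow> psi (sig i) (x_gen t) = sigma_img (Suc i) t"
  using psi_generator [of "Sig (Suc i)"] by (simp add: sig_def F_hom_gen sigma_img_closed)

lemma psi_alp [simp]: "t \<in> pos_seqs \<Longrightarrow> psi (alp i) (x_gen t) = alpha_img (Suc i) t"
  using psi_generator [of "Alpha (Suc i)"] by (simp add: alp_def F_hom_gen alpha_img_closed)

lemma subgroup_invariance:
  "subgroup {g \<in> carrier B_bullet. \<forall>c\<in>carrier F_bullet. e (psi g c) = e c} B_bullet"
proof (rule B.subgroupI)
  fix g assume g: "g \<in> {g \<in> carrier B_bullet. \<forall>c\<in>carrier F_bullet. e (psi g c) = e c}"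
  have "e (psi (inv\<^bsub>B_bullet\<^esub> g) c) = e c" if "c \<in> carrier F_bullet" for c
  proof -
    have "psi (inv\<^bsub>B_bullet\<^esub> g) c \<in> carrier F_bullet" using g that by simp
    then have "e (psi g (psi (inv\<^bsub>B_bullet\<^esub> g) c)) = e (psi (inv\<^bsub>B_bullet\<^esub> g) c)"
      using g by blast
    then show ?thesis using g that by simp
  qed
  then show "inv\<^bsub>B_bullet\<^esub> g \<in> {g \<in> carrier B_bullet. \<forall>c\<in>carrier F_bullet. e (psi g c) = e c}"
    using g by simp
qed (auto intro!: exI [of _ "\<one>\<^bsub>B_bullet\<^esub>"])

lemma subgroup_fixes:
  assumes c: "c \<in> carrier F_bullet"
  shows "subgroup {g \<in> carrier B_bullet. psi g c = c} B_bullet"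
proof (rule B.subgroupI)
  fix g assume g: "g \<in> {g \<in> carrier B_bullet. psi g c = c}"
  then have "psi (inv\<^bsub>B_bullet\<^esub> g) c = c" using psi_inv(1) [of g c] c by simp
  then show "inv\<^bsub>B_bullet\<^esub> g \<in> {g \<in> carrier B_bullet. psi g c = c}" using g by simp
qed (use c in \<open>auto intro!: exI [of _ "\<one>\<^bsub>B_bullet\<^esub>"]\<close>)

text \<open>The exponent sum of the basis elements of length one with shifted index in
  \<open>J\<close>. \<open>UNIV\<close> measures forests, a singleton tells strands apart.\<close>

definition deg :: "nat set \<Rightarrow> nat list word set \<Rightarrow> int" where
  "deg J = F_ext integer_group (\<lambda>t. if \<exists>j\<in>J. t = [Suc j] then 1 else 0)"

lemma deg_hom: "deg J \<in> hom F_bullet integer_group"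
  unfolding deg_def by (rule group.F_ext_hom) auto

lemma deg_gen [simp]:
  "t \<in> pos_seqs \<Longrightarrow> deg J (x_gen t) = (if \<exists>j\<in>J. t = [Suc j] then 1 else 0)"
  unfolding deg_def by (subst group.F_ext_gen) auto

lemma deg_mult [simp]:
  "c \<in> carrier F_bullet \<Longrightarrow> d \<in> carrier F_bullet \<Longrightarrow> deg J (c \<otimes>\<^bsub>F_bullet\<^esub> d) = deg J c + deg J d"
  using hom_mult [OF deg_hom] by simp

lemma deg_inv [simp]: "c \<in> carrier F_bullet \<Longrightarrow> deg J (inv\<^bsub>F_bullet\<^esub> c) = - deg J c"
proof -
  interpret group_hom F_bullet integer_group "deg J"
    by (intro group_hom.intro group_hom_axioms.intro F.is_group group_integer_group deg_hom)
  show "c \<in> carrier F_bullet \<Longrightarrow> deg J (inv\<^bsub>F_bullet\<^esub> c) = - deg J c"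
    by (simp add: hom_inv)
qed

lemma pos_seqs_cases:
  assumes "t \<in> pos_seqs"
  obtains j u where "t = Suc j # u" "\<forall>k\<in>set u. Suc 0 \<le> k"
proof (cases t)
  case (Cons k u)
  then show ?thesis using assms that [of "k - 1" u] by simp
qed (use assms in simp)

lemma deg_psi_sig: "c \<in> carrier F_bullet \<Longrightarrow> deg UNIV (psi (sig i) c) = deg UNIV c"
proof (rule group.F_hom_eqI [OF group_integer_group, of "\<lambda>c. deg UNIV (psi (sig i) c)"])
  show "(\<lambda>c. deg UNIV (psi (sig i) c)) \<in> hom F_bullet integer_group"
    by (rule homI) simp_all
  fix t assume "t \<in> pos_seqs"
  then show "deg UNIV (psi (sig i) (x_gen t)) = deg UNIV (x_gen t)"
    by (elim pos_seqs_cases) auto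
qed (rule deg_hom)

section \<open>Faithfulness of the Artin representation\<close>

text \<open>The basis elements \<open>x1 n\<close>, later strands and longer sequences all go to the
  unit, so the map lives on the whole of \<open>F_bullet\<close>; \<open>hd t - 1\<close> recovers
  \<open>k\<close> from \<open>[Suc k]\<close>.\<close>

definition eta :: "nat \<Rightarrow> nat list word set \<Rightarrow> pb_gen word set" where
  "eta n = F_ext B_bullet (\<lambda>t. if \<exists>k<n. t = [Suc k]
     then inv\<^bsub>B_bullet\<^esub> braid.pure_gen n (hd t - 1) else \<one>\<^bsub>B_bullet\<^esub>)"

lemma eta_hom: "eta n \<in> hom F_bullet B_bullet"
  unfolding eta_def by (rule B.F_ext_hom) auto

lemma eta_gen [simp]:
  "\<forall>k\<in>set u. Suc 0 \<le> k \<Longrightarrow> eta n (x_gen (Suc k # u)) =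
    (if u = [] \<and> k < n then inv\<^bsub>B_bullet\<^esub> braid.pure_gen n k else \<one>\<^bsub>B_bullet\<^esub>)"
  unfolding eta_def by (subst B.F_ext_gen) auto

lemma eta_closed [simp]: "c \<in> carrier F_bullet \<Longrightarrow> eta n c \<in> carrier B_bullet"
  using eta_hom by (rule hom_in_carrier)

lemma eta_mult [simp]:
  "c \<in> carrier F_bullet \<Longrightarrow> d \<in> carrier F_bullet \<Longrightarrow>
    eta n (c \<otimes>\<^bsub>F_bullet\<^esub> d) = eta n c \<otimes>\<^bsub>B_bullet\<^esub> eta n d"
  using eta_hom by (rule hom_mult)

lemma eta_inv [simp]: "c \<in> carrier F_bullet \<Longrightarrow> eta n (inv\<^bsub>F_bullet\<^esub> c) = inv\<^bsub>B_bullet\<^esub> (eta n c)"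
proof -
  interpret group_hom F_bullet B_bullet "eta n"
    by (intro group_hom.intro group_hom_axioms.intro F.is_group B.is_group eta_hom)
  show "c \<in> carrier F_bullet \<Longrightarrow> eta n (inv\<^bsub>F_bullet\<^esub> c) = inv\<^bsub>B_bullet\<^esub> (eta n c)"
    by (rule hom_inv)
qed

text \<open>Braids on the strands 0 to n - 1: the condition \<open>Suc i < n\<close> leaves out
  \<open>sig (n - 1)\<close>, which would move \<open>x1 n\<close>.\<close>

definition low_braids :: "nat \<Rightarrow> pb_gen word set set" where
  "low_braids n = generate B_bullet (sig ` {i. Suc i < n})"

lemma low_braids_subgroup: "subgroup (low_braids n) B_bullet"
  unfolding low_braids_def by (rule B.generate_is_subgroup) auto

lemma low_braids_closed [simp]: "h \<in> low_braids n \<Longrightarrow> h \<in> carrier B_bullet"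
  using low_braids_subgroup subgroup.mem_carrier by metis

lemma low_braids_sig: "Suc i < n \<Longrightarrow> sig i \<in> low_braids n"
  unfolding low_braids_def by (auto intro: generate.incl)

lemma low_braids_subset:
  "subgroup H B_bullet \<Longrightarrow> (\<And>i. Suc i < n \<Longrightarrow> sig i \<in> H) \<Longrightarrow> low_braids n \<subseteq> H"
  unfolding low_braids_def by (rule B.generate_subgroup_incl) auto

lemma low_braids_fix: "h \<in> low_braids n \<Longrightarrow> psi h (x1 n) = x1 n"
  using low_braids_subset [OF subgroup_fixes [of "x1 n"], of n] by auto

text \<open>The two crossing strands are covered by the conjugation formulas, other strands below
  \<open>n\<close> by \<open>pure_gen_comm\<close>; for the remaining basis elements both sides are
  trivial.\<close>

lemma eta_equivariant_sig:
  assumes i: "Suc i < n" and c: "c \<in> carrier F_bullet"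
  shows "eta n (psi (sig i) c) = sig i \<otimes>\<^bsub>B_bullet\<^esub> eta n c \<otimes>\<^bsub>B_bullet\<^esub> inv\<^bsub>B_bullet\<^esub> sig i"
proof (rule B.F_hom_eqI [OF _ _ _ c, of "\<lambda>c. eta n (psi (sig i) c)"])
  show "(\<lambda>c. eta n (psi (sig i) c)) \<in> hom F_bullet B_bullet"
    by (rule homI) simp_all
  show "(\<lambda>c. sig i \<otimes>\<^bsub>B_bullet\<^esub> eta n c \<otimes>\<^bsub>B_bullet\<^esub> inv\<^bsub>B_bullet\<^esub> sig i) \<in> hom F_bullet B_bullet"
    by (rule homI) (simp_all add: B.m_assoc braid.cancel_left)
  fix t assume "t \<in> pos_seqs"
  then show "eta n (psi (sig i) (x_gen t)) =
      sig i \<otimes>\<^bsub>B_bullet\<^esub> eta n (x_gen t) \<otimes>\<^bsub>B_bullet\<^esub> inv\<^bsub>B_bullet\<^esub> sig i"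
  proof (elim pos_seqs_cases)
    fix j u assume t: "t = Suc j # u" and u: "\<forall>k\<in>set u. Suc 0 \<le> k"
    consider "j = i" | "j = Suc i" | "j < i \<or> Suc (Suc i) \<le> j" by linarith
    then show ?thesis
    proof cases
      case 1
      then show ?thesis using i u by (simp add: t braid.pure_gen_conj_same)
    next
      case 2
      then show ?thesis using i u by (simp add: t braid.pure_gen_conj_Suc)
    next
      case 3
      then have "sig i \<otimes>\<^bsub>B_bullet\<^esub> inv\<^bsub>B_bullet\<^esub> braid.pure_gen n j \<otimes>\<^bsub>B_bullet\<^esub>
          inv\<^bsub>B_bullet\<^esub> sig i = inv\<^bsub>B_bullet\<^esub> braid.pure_gen n j"
        using i braid.pure_gen_comm [of i j n] by (intro B.conj_inv_eqI) auto
      moreover have "j \<noteq> i" "j \<noteq> Suc i" using 3 by auto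
      ultimately show ?thesis using u by (simp add: t)
    qed
  qed
qed

lemma eta_equivariant:
  assumes "h \<in> low_braids n" "c \<in> carrier F_bullet"
  shows "eta n (psi h c) = h \<otimes>\<^bsub>B_bullet\<^esub> eta n c \<otimes>\<^bsub>B_bullet\<^esub> inv\<^bsub>B_bullet\<^esub> h"
proof -
  let ?E = "{h \<in> carrier B_bullet. \<forall>c\<in>carrier F_bullet.
    eta n (psi h c) = h \<otimes>\<^bsub>B_bullet\<^esub> eta n c \<otimes>\<^bsub>B_bullet\<^esub> inv\<^bsub>B_bullet\<^esub> h}"
  have "subgroup ?E B_bullet"
  proof (rule B.subgroupI)
    fix h assume h: "h \<in> ?E"
    have "eta n (psi (inv\<^bsub>B_bullet\<^esub> h) c) = inv\<^bsub>B_bullet\<^esub> h \<otimes>\<^bsub>B_bullet\<^esub> eta n c \<otimes>\<^bsub>B_bullet\<^esub> h"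
      if c: "c \<in> carrier F_bullet" for c
    proof -
      let ?d = "psi (inv\<^bsub>B_bullet\<^esub> h) c"
      have d: "?d \<in> carrier F_bullet" using h c by simp
      have "eta n (psi h ?d) = h \<otimes>\<^bsub>B_bullet\<^esub> eta n ?d \<otimes>\<^bsub>B_bullet\<^esub> inv\<^bsub>B_bullet\<^esub> h"
        using h d by blast
      then have "eta n c = h \<otimes>\<^bsub>B_bullet\<^esub> eta n ?d \<otimes>\<^bsub>B_bullet\<^esub> inv\<^bsub>B_bullet\<^esub> h"
        using h c by simp
      then show ?thesis using h d by (simp add: B.m_assoc braid.cancel_left)
    qed
    then show "inv\<^bsub>B_bullet\<^esub> h \<in> ?E" using h by simp
  next
    fix g h assume "g \<in> ?E" "h \<in> ?E"
    then show "g \<otimes>\<^bsub>B_bullet\<^esub> h \<in> ?E" by (simp add: B.m_assoc B.inv_mult_group)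
  qed (auto intro!: exI [of _ "\<one>\<^bsub>B_bullet\<^esub>"])
  then have "low_braids n \<subseteq> ?E"
    by (rule low_braids_subset) (simp add: eta_equivariant_sig)
  then show ?thesis using assms by blast
qed

text \<open>The braids obtained by dragging the strand \<open>n\<close> around the others: \<open>eta n\<close> recovers such a
  braid from the element of the free group that conjugates \<open>x1 n\<close>.\<close>

definition drags :: "nat \<Rightarrow> pb_gen word set set" where
  "drags n = {t \<in> carrier B_bullet. (\<forall>c\<in>carrier F_bullet. eta n (psi t c) = eta n c) \<and>
    (\<exists>g\<in>carrier F_bullet. psi t (x1 n) = g \<otimes>\<^bsub>F_bullet\<^esub> x1 n \<otimes>\<^bsub>F_bullet\<^esub> inv\<^bsub>F_bullet\<^esub> g \<and>
      eta n g = inv\<^bsub>B_bullet\<^esub> t)}"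

lemma dragsI:
  "\<lbrakk>t \<in> carrier B_bullet; \<And>c. c \<in> carrier F_bullet \<Longrightarrow> eta n (psi t c) = eta n c;
    g \<in> carrier F_bullet; psi t (x1 n) = g \<otimes>\<^bsub>F_bullet\<^esub> x1 n \<otimes>\<^bsub>F_bullet\<^esub> inv\<^bsub>F_bullet\<^esub> g;
    eta n g = inv\<^bsub>B_bullet\<^esub> t\<rbrakk> \<Longrightarrow> t \<in> drags n"
  by (auto simp: drags_def)

lemma dragsE:
  assumes "t \<in> drags n"
  obtains g where "t \<in> carrier B_bullet" "\<And>c. c \<in> carrier F_bullet \<Longrightarrow> eta n (psi t c) = eta n c"
    "g \<in> carrier F_bullet" "psi t (x1 n) = g \<otimes>\<^bsub>F_bullet\<^esub> x1 n \<otimes>\<^bsub>F_bullet\<^esub> inv\<^bsub>F_bullet\<^esub> g"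
    "eta n g = inv\<^bsub>B_bullet\<^esub> t"
  using assms by (auto simp: drags_def)

text \<open>If \<open>t\<close> and \<open>u\<close> conjugate \<open>x1 n\<close> by
  \<open>g\<close> and \<open>h\<close>, then t u conjugates it by the product of
  \<open>psi t h\<close> and \<open>g\<close>. As \<open>eta n\<close> ignores \<open>psi t\<close>,
  this goes to u^-1 t^-1, whence the invariance and the inverse in the definition.\<close>

lemma drags_subgroup: "subgroup (drags n) B_bullet"
proof (rule B.subgroupI)
  show "drags n \<subseteq> carrier B_bullet" by (auto simp: drags_def)
  have "\<one>\<^bsub>B_bullet\<^esub> \<in> drags n"
    using hom_one [OF eta_hom F.is_group B.is_group]
    by (intro dragsI [where g = "\<one>\<^bsub>F_bullet\<^esub>"]) auto
  then show "drags n \<noteq> {}" by blast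
next
  fix t assume "t \<in> drags n"
  then obtain g where t: "t \<in> carrier B_bullet" "\<And>c. c \<in> carrier F_bullet \<Longrightarrow> eta n (psi t c) = eta n c"
    and g: "g \<in> carrier F_bullet" "psi t (x1 n) = g \<otimes>\<^bsub>F_bullet\<^esub> x1 n \<otimes>\<^bsub>F_bullet\<^esub> inv\<^bsub>F_bullet\<^esub> g"
    "eta n g = inv\<^bsub>B_bullet\<^esub> t"
    by (elim dragsE) blast
  let ?i = "inv\<^bsub>B_bullet\<^esub> t"
  have inv: "eta n (psi ?i c) = eta n c" if "c \<in> carrier F_bullet" for c
    using t(2) [of "psi ?i c"] t(1) that by simp
  have "x1 n = psi ?i (g \<otimes>\<^bsub>F_bullet\<^esub> x1 n \<otimes>\<^bsub>F_bullet\<^esub> inv\<^bsub>F_bullet\<^esub> g)"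
    using t(1) by (simp flip: g(2))
  then have "x1 n = psi ?i g \<otimes>\<^bsub>F_bullet\<^esub> psi ?i (x1 n) \<otimes>\<^bsub>F_bullet\<^esub> inv\<^bsub>F_bullet\<^esub> psi ?i g"
    using t(1) g(1) by simp
  then have "psi ?i (inv\<^bsub>F_bullet\<^esub> g) \<otimes>\<^bsub>F_bullet\<^esub> x1 n \<otimes>\<^bsub>F_bullet\<^esub> inv\<^bsub>F_bullet\<^esub> (psi ?i (inv\<^bsub>F_bullet\<^esub> g)) =
      psi ?i (inv\<^bsub>F_bullet\<^esub> g) \<otimes>\<^bsub>F_bullet\<^esub> (psi ?i g \<otimes>\<^bsub>F_bullet\<^esub> psi ?i (x1 n) \<otimes>\<^bsub>F_bullet\<^esub> inv\<^bsub>F_bullet\<^esub> psi ?i g)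
        \<otimes>\<^bsub>F_bullet\<^esub> inv\<^bsub>F_bullet\<^esub> (psi ?i (inv\<^bsub>F_bullet\<^esub> g))"
    by simp
  also have "\<dots> = psi ?i (x1 n)" using t(1) g(1) by (simp add: F.m_assoc F_cancel del: psi_sig)
  finally show "?i \<in> drags n"
    using t g by (intro dragsI [where g = "psi ?i (inv\<^bsub>F_bullet\<^esub> g)"] inv) (simp_all add: inv)
next
  fix t u assume "t \<in> drags n" "u \<in> drags n"
  then obtain g h where t: "t \<in> carrier B_bullet" "\<And>c. c \<in> carrier F_bullet \<Longrightarrow> eta n (psi t c) = eta n c"
    and g: "g \<in> carrier F_bullet" "psi t (x1 n) = g \<otimes>\<^bsub>F_bullet\<^esub> x1 n \<otimes>\<^bsub>F_bullet\<^esub> inv\<^bsub>F_bullet\<^esub> g"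
    "eta n g = inv\<^bsub>B_bullet\<^esub> t"
    and u: "u \<in> carrier B_bullet" "\<And>c. c \<in> carrier F_bullet \<Longrightarrow> eta n (psi u c) = eta n c"
    and h: "h \<in> carrier F_bullet" "psi u (x1 n) = h \<otimes>\<^bsub>F_bullet\<^esub> x1 n \<otimes>\<^bsub>F_bullet\<^esub> inv\<^bsub>F_bullet\<^esub> h"
    "eta n h = inv\<^bsub>B_bullet\<^esub> u"
    by (elim dragsE) blast
  show "t \<otimes>\<^bsub>B_bullet\<^esub> u \<in> drags n"
    using t u g h
    by (intro dragsI [where g = "psi t h \<otimes>\<^bsub>F_bullet\<^esub> g"])
       (simp_all add: F.m_assoc F.inv_mult_group B.inv_mult_group)
qed

text \<open>As \<open>h\<close> fixes \<open>x1 n\<close>, the conjugate h t h^-1 has conjugator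
  \<open>psi h g\<close>, which equivariance maps to h t^-1 h^-1.\<close>

lemma drags_conj:
  assumes h: "h \<in> low_braids n" and "t \<in> drags n"
  shows "h \<otimes>\<^bsub>B_bullet\<^esub> t \<otimes>\<^bsub>B_bullet\<^esub> inv\<^bsub>B_bullet\<^esub> h \<in> drags n"
proof -
  from \<open>t \<in> drags n\<close>
  obtain g where t: "t \<in> carrier B_bullet" "\<And>c. c \<in> carrier F_bullet \<Longrightarrow> eta n (psi t c) = eta n c"
    and g: "g \<in> carrier F_bullet" "psi t (x1 n) = g \<otimes>\<^bsub>F_bullet\<^esub> x1 n \<otimes>\<^bsub>F_bullet\<^esub> inv\<^bsub>F_bullet\<^esub> g"
    "eta n g = inv\<^bsub>B_bullet\<^esub> t"
    by (elim dragsE) blast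
  have h': "inv\<^bsub>B_bullet\<^esub> h \<in> low_braids n"
    using subgroup.m_inv_closed [OF low_braids_subgroup h] .
  note [simp] = low_braids_closed [OF h] low_braids_fix [OF h] low_braids_fix [OF h']
    eta_equivariant [OF h] eta_equivariant [OF h']
  show ?thesis
    using t g
    by (intro dragsI [where g = "psi h g"])
       (simp_all add: B.m_assoc B.inv_mult_group braid.cancel_left)
qed

text \<open>Downward induction: for \<open>k = m\<close> the square of \<open>sig m\<close>
  conjugates \<open>x1 (Suc m)\<close> by \<open>x1 m\<close>, and smaller \<open>k\<close> are
  reached by conjugating with \<open>sig k\<close>.\<close>

lemma pure_gen_drags: "k \<le> m \<Longrightarrow> braid.pure_gen (Suc m) k \<in> drags (Suc m)"
proof (induction rule: inc_induct)
    case base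
    have p: "braid.pure_gen (Suc m) m = sig m \<otimes>\<^bsub>B_bullet\<^esub> sig m"
      by (simp add: braid.pure_gen_def)
    show ?case
    proof (rule dragsI [where g = "x1 m"])
      fix c assume c: "c \<in> carrier F_bullet"
      show "eta (Suc m) (psi (braid.pure_gen (Suc m) m) c) = eta (Suc m) c"
      proof (rule B.F_hom_eqI [OF _ eta_hom _ c, of "\<lambda>c. eta (Suc m) (psi (braid.pure_gen (Suc m) m) c)"])
        show "(\<lambda>c. eta (Suc m) (psi (braid.pure_gen (Suc m) m) c)) \<in> hom F_bullet B_bullet"
          by (rule homI) simp_all
        fix t assume "t \<in> pos_seqs"
        then show "eta (Suc m) (psi (braid.pure_gen (Suc m) m) (x_gen t)) = eta (Suc m) (x_gen t)"
          by (elim pos_seqs_cases) (simp add: p B.m_assoc braid.cancel_left)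
      qed
    qed (simp_all add: p)
  next
    case (step k)
    then have "sig k \<otimes>\<^bsub>B_bullet\<^esub> braid.pure_gen (Suc m) (Suc k) \<otimes>\<^bsub>B_bullet\<^esub> inv\<^bsub>B_bullet\<^esub> sig k \<in> drags (Suc m)"
      by (intro drags_conj low_braids_sig) auto
    moreover have "braid.pure_gen (Suc m) k =
        sig k \<otimes>\<^bsub>B_bullet\<^esub> braid.pure_gen (Suc m) (Suc k) \<otimes>\<^bsub>B_bullet\<^esub> inv\<^bsub>B_bullet\<^esub> sig k"
      using braid.pure_gen_Suc [of k "Suc m"] step.hyps
      by (simp add: B.m_assoc [symmetric] B.inv_solve_right)
    ultimately show ?case by simp
qed

lemma psi_ridge: "k \<le> n \<Longrightarrow> psi (braid.ridge n k) (x1 n) = x1 k"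
proof (induction rule: inc_induct)
  case (step k)
  then show ?case by (simp add: braid.ridge_step)
qed simp

theorem artin_faithful:
  assumes "g \<in> generate B_bullet (sig ` {..<n})" and "\<And>c. c \<in> carrier F_bullet \<Longrightarrow> psi g c = c"
  shows "g = \<one>\<^bsub>B_bullet\<^esub>"
  using assms
proof (induction n arbitrary: g)
  case 0
  then show ?case by (simp add: B.generate_empty)
next
  case (Suc m)
  let ?n = "Suc m"
  obtain k h t where k: "k \<le> ?n" and h: "h \<in> low_braids ?n" and "t \<in> drags ?n"
    and g: "g = braid.ridge ?n k \<otimes>\<^bsub>B_bullet\<^esub> (h \<otimes>\<^bsub>B_bullet\<^esub> t)"
  proof (rule braid.combing [OF drags_subgroup _ _ Suc.prems(1)])
    fix h t assume "h \<in> generate B_bullet (sig ` {i. Suc i < ?n})" "t \<in> drags ?n"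
    then have h: "h \<in> low_braids ?n" and t: "t \<in> drags ?n" by (simp_all add: low_braids_def)
    show "inv\<^bsub>B_bullet\<^esub> h \<otimes>\<^bsub>B_bullet\<^esub> t \<otimes>\<^bsub>B_bullet\<^esub> h \<in> drags ?n"
      using drags_conj [OF subgroup.m_inv_closed [OF low_braids_subgroup h] t] h by simp
  qed (simp_all add: low_braids_def pure_gen_drags)
  obtain y where t: "t \<in> carrier B_bullet" and y: "y \<in> carrier F_bullet"
    and ty: "psi t (x1 ?n) = y \<otimes>\<^bsub>F_bullet\<^esub> x1 ?n \<otimes>\<^bsub>F_bullet\<^esub> inv\<^bsub>F_bullet\<^esub> y" "eta ?n y = inv\<^bsub>B_bullet\<^esub> t"
    using \<open>t \<in> drags ?n\<close> by (elim dragsE) blast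
  note hc = low_braids_closed [OF h] and hx = low_braids_fix [OF h]
  have "x1 ?n = psi g (x1 ?n)" using Suc.prems(2) by simp
  also have "\<dots> = psi (braid.ridge ?n k) (psi h y \<otimes>\<^bsub>F_bullet\<^esub> x1 ?n \<otimes>\<^bsub>F_bullet\<^esub> inv\<^bsub>F_bullet\<^esub> psi h y)"
    using t y hc by (simp add: g ty hx)
  \<comment> \<open>This exponent sum ignores the conjugation, and the ridge maps
    \<open>x1 ?n\<close> to \<open>x1 k\<close>, so the ridge must be empty.\<close>
  finally have "deg {?n} (x1 ?n) =
      deg {?n} (psi (braid.ridge ?n k) (psi h y \<otimes>\<^bsub>F_bullet\<^esub> x1 ?n \<otimes>\<^bsub>F_bullet\<^esub> inv\<^bsub>F_bullet\<^esub> psi h y))"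
    by (rule arg_cong)
  then have "k = ?n"
    using y hc by (simp add: psi_ridge [OF k] split: if_splits)
  then have g: "g = h \<otimes>\<^bsub>B_bullet\<^esub> t" using g t hc by simp
  \<comment> \<open>Both \<open>g\<close> and \<open>h\<close> fix \<open>x1 ?n\<close>, hence so
    does \<open>t\<close>, and its conjugator \<open>y\<close> commutes with \<open>x1 ?n\<close>,
    which \<open>eta ?n\<close> kills.\<close>
  have "psi h (psi t (x1 ?n)) = psi h (x1 ?n)"
    using Suc.prems(2) [of "x1 ?n"] t hc by (simp add: g hx)
  then have "psi (inv\<^bsub>B_bullet\<^esub> h) (psi h (psi t (x1 ?n))) = psi (inv\<^bsub>B_bullet\<^esub> h) (psi h (x1 ?n))"
    by simp
  then have "y \<otimes>\<^bsub>F_bullet\<^esub> x1 ?n \<otimes>\<^bsub>F_bullet\<^esub> inv\<^bsub>F_bullet\<^esub> y = x1 ?n"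
    using t hc y by (simp add: ty)
  then have "y \<otimes>\<^bsub>F_bullet\<^esub> x1 ?n \<otimes>\<^bsub>F_bullet\<^esub> inv\<^bsub>F_bullet\<^esub> y \<otimes>\<^bsub>F_bullet\<^esub> y = x1 ?n \<otimes>\<^bsub>F_bullet\<^esub> y"
    by simp
  then have comm: "y \<otimes>\<^bsub>F_bullet\<^esub> x1 ?n = x1 ?n \<otimes>\<^bsub>F_bullet\<^esub> y"
    using y by (simp add: F.m_assoc)
  have "eta ?n y = \<one>\<^bsub>B_bullet\<^esub>"
    by (rule B.F_centralizer [OF eta_hom _ _ y comm]) simp_all
  then have "g = h" using ty t g hc by (simp add: B.inv_eq_1_iff)
  moreover have "h \<in> generate B_bullet (sig ` {..<m})"
    using h by (simp add: low_braids_def lessThan_def)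
  ultimately show ?case using Suc by simp
qed

section \<open>Fractions with a braid in the middle\<close>

definition braids :: "pb_gen word set set" where
  "braids = generate B_bullet (range sig)"

lemma braids_subgroup: "subgroup braids B_bullet"
  unfolding braids_def by (rule B.generate_is_subgroup) auto

lemma braids_closed [simp]: "g \<in> braids \<Longrightarrow> g \<in> carrier B_bullet"
  using braids_subgroup subgroup.mem_carrier by metis

lemmas braids_mult = subgroup.m_closed [OF braids_subgroup]
  and braids_inv = subgroup.m_inv_closed [OF braids_subgroup]
  and braids_one = subgroup.one_closed [OF braids_subgroup]

lemma braids_sig [simp]: "sig i \<in> braids"
  unfolding braids_def by (auto intro: generate.incl)

lemma braids_finite_support: "g \<in> braids \<Longrightarrow> \<exists>n. g \<in> generate B_bullet (sig ` {..<n})"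
  unfolding braids_def
proof (induction rule: generate.induct)
  case (incl h)
  then obtain i where "h = sig i" by blast
  then show ?case by (intro exI [of _ "Suc i"] generate.incl) simp
next
  case (inv h)
  then obtain i where "h = sig i" by blast
  then show ?case by (intro exI [of _ "Suc i"]) (auto intro: generate.inv)
next
  case (eng g h)
  then obtain m n where mn: "g \<in> generate B_bullet (sig ` {..<m})" "h \<in> generate B_bullet (sig ` {..<n})"
    by blast
  have "generate B_bullet (sig ` {..<l}) \<subseteq> generate B_bullet (sig ` {..<max m n})" if "l \<in> {m, n}" for l
    using that by (intro B.mono_generate image_mono) auto
  with mn have "g \<in> generate B_bullet (sig ` {..<max m n})" "h \<in> generate B_bullet (sig ` {..<max m n})"
    by blast+
  then show ?case by (blast intro: generate.eng)
qed (auto intro: generate.one)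

lemma braid_faithful:
  "g \<in> braids \<Longrightarrow> (\<And>c. c \<in> carrier F_bullet \<Longrightarrow> psi g c = c) \<Longrightarrow> g = \<one>\<^bsub>B_bullet\<^esub>"
  using braids_finite_support artin_faithful by blast

lemma deg_psi_braid: "g \<in> braids \<Longrightarrow> c \<in> carrier F_bullet \<Longrightarrow> deg UNIV (psi g c) = deg UNIV c"
proof -
  have "braids \<subseteq> {g \<in> carrier B_bullet. \<forall>c\<in>carrier F_bullet. deg UNIV (psi g c) = deg UNIV c}"
    unfolding braids_def
    by (rule B.generate_subgroup_incl [OF _ subgroup_invariance]) (auto simp: deg_psi_sig)
  then show "g \<in> braids \<Longrightarrow> c \<in> carrier F_bullet \<Longrightarrow> deg UNIV (psi g c) = deg UNIV c" by blast
qed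

text \<open>Products of the a's are pictured as binary forests, each letter adding a caret.
  Different lists may give the same element.\<close>

fun forest :: "nat list \<Rightarrow> pb_gen word set" where
  "forest [] = \<one>\<^bsub>B_bullet\<^esub>"
| "forest (j # js) = alp j \<otimes>\<^bsub>B_bullet\<^esub> forest js"

lemma forest_closed [simp]: "forest js \<in> carrier B_bullet"
  by (induction js) auto

lemma forest_append: "forest (js @ ks) = forest js \<otimes>\<^bsub>B_bullet\<^esub> forest ks"
  by (induction js) (auto simp: B.m_assoc)

text \<open>A caret slides along its strand through the crossing, hence the transposition; a
  crossing that involves this strand becomes two.\<close>

lemma alp_sig:
  "\<exists>b\<in>braids. alp j \<otimes>\<^bsub>B_bullet\<^esub> sig i = b \<otimes>\<^bsub>B_bullet\<^esub> alp (transpose i (Suc i) j)"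
proof -
  consider "j < i" | "j = i" | "j = Suc i" | "Suc (Suc i) \<le> j" by linarith
  then show ?thesis
  proof cases
    case 1
    then show ?thesis by (intro bexI [of _ "sig (Suc i)"]) (simp_all add: B_relations(4) transpose_def)
  next
    case 2
    then show ?thesis
      by (intro bexI [of _ "sig (Suc i) \<otimes>\<^bsub>B_bullet\<^esub> sig i"]) (simp_all add: B_relations(6) braids_mult)
  next
    case 3
    then show ?thesis
      by (intro bexI [of _ "sig i \<otimes>\<^bsub>B_bullet\<^esub> sig (Suc i)"]) (simp_all add: B_relations(7) braids_mult)
  next
    case 4
    then show ?thesis
      using B_relations(2) [OF 4] by (intro bexI [of _ "sig i"]) (simp_all add: transpose_def)
  qed
qed

text \<open>A braid permutes the caret positions, so the index can be prescribed on either side; the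
  second form serves for inverses of forests.\<close>

lemma alp_braid:
  assumes "b \<in> braids"
  shows "\<exists>k. \<exists>b'\<in>braids. alp j \<otimes>\<^bsub>B_bullet\<^esub> b = b' \<otimes>\<^bsub>B_bullet\<^esub> alp k"
    and "\<exists>k. \<exists>b'\<in>braids. alp k \<otimes>\<^bsub>B_bullet\<^esub> b = b' \<otimes>\<^bsub>B_bullet\<^esub> alp j"
proof -
  define Q where "Q j b k \<longleftrightarrow> (\<exists>b'\<in>braids. alp j \<otimes>\<^bsub>B_bullet\<^esub> b = b' \<otimes>\<^bsub>B_bullet\<^esub> alp k)" for j b k
  have Q_sig: "Q j (sig i) (transpose i (Suc i) j)" for i j
    using alp_sig by (simp add: Q_def)
  \<comment> \<open>Inverting the braid exchanges the two indices.\<close>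
  have Q_inv: "Q k (inv\<^bsub>B_bullet\<^esub> h) j" if "Q j h k" "h \<in> carrier B_bullet" for j k h
  proof -
    from that obtain b' where b': "b' \<in> braids" "alp j \<otimes>\<^bsub>B_bullet\<^esub> h = b' \<otimes>\<^bsub>B_bullet\<^esub> alp k"
      by (auto simp: Q_def)
    have "inv\<^bsub>B_bullet\<^esub> b' \<otimes>\<^bsub>B_bullet\<^esub> alp j =
        inv\<^bsub>B_bullet\<^esub> b' \<otimes>\<^bsub>B_bullet\<^esub> (alp j \<otimes>\<^bsub>B_bullet\<^esub> h \<otimes>\<^bsub>B_bullet\<^esub> inv\<^bsub>B_bullet\<^esub> h)"
      using that by (simp add: B.m_assoc)
    also have "\<dots> = alp k \<otimes>\<^bsub>B_bullet\<^esub> inv\<^bsub>B_bullet\<^esub> h"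
      unfolding b'(2) using that b'(1) by (simp add: B.m_assoc braid.cancel_left)
    finally have "alp k \<otimes>\<^bsub>B_bullet\<^esub> inv\<^bsub>B_bullet\<^esub> h = inv\<^bsub>B_bullet\<^esub> b' \<otimes>\<^bsub>B_bullet\<^esub> alp j" ..
    then show ?thesis using braids_inv [OF b'(1)] by (auto simp: Q_def)
  qed
  have Q_mult: "Q j (g \<otimes>\<^bsub>B_bullet\<^esub> h) l" if "Q j g k" "Q k h l" "g \<in> carrier B_bullet" "h \<in> carrier B_bullet"
    for j k l g h
  proof -
    from that obtain c d where c: "c \<in> braids" "alp j \<otimes>\<^bsub>B_bullet\<^esub> g = c \<otimes>\<^bsub>B_bullet\<^esub> alp k"
      and d: "d \<in> braids" "alp k \<otimes>\<^bsub>B_bullet\<^esub> h = d \<otimes>\<^bsub>B_bullet\<^esub> alp l"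
      by (auto simp: Q_def)
    have "alp j \<otimes>\<^bsub>B_bullet\<^esub> (g \<otimes>\<^bsub>B_bullet\<^esub> h) = c \<otimes>\<^bsub>B_bullet\<^esub> (alp k \<otimes>\<^bsub>B_bullet\<^esub> h)"
      using that c by (simp add: B.m_assoc [symmetric])
    also have "\<dots> = c \<otimes>\<^bsub>B_bullet\<^esub> d \<otimes>\<^bsub>B_bullet\<^esub> alp l"
      using c d by (simp add: B.m_assoc)
    finally show ?thesis using braids_mult [OF c(1) d(1)] by (auto simp: Q_def)
  qed
  have "(\<forall>j. \<exists>k. Q j b k) \<and> (\<forall>j. \<exists>k. Q k b j)"
    using assms unfolding braids_def
  proof (induction rule: generate.induct)
    case one
    have "Q j \<one>\<^bsub>B_bullet\<^esub> j" for j
      unfolding Q_def by (intro bexI [OF _ braids_one]) simp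
    then show ?case by blast
  next
    case (incl h)
    then obtain i where "h = sig i" by blast
    then show ?case using Q_sig by (metis transpose_involutory)
  next
    case (inv h)
    then obtain i where "h = sig i" by blast
    then show ?case using Q_sig Q_inv by (metis transpose_involutory sig_closed)
  next
    case (eng g h)
    then have "g \<in> carrier B_bullet" "h \<in> carrier B_bullet"
      using braids_closed [unfolded braids_def] by blast+
    with eng.IH show ?case using Q_mult by meson
  qed
  then show "\<exists>k. \<exists>b'\<in>braids. alp j \<otimes>\<^bsub>B_bullet\<^esub> b = b' \<otimes>\<^bsub>B_bullet\<^esub> alp k"
    "\<exists>k. \<exists>b'\<in>braids. alp k \<otimes>\<^bsub>B_bullet\<^esub> b = b' \<otimes>\<^bsub>B_bullet\<^esub> alp j"
    by (auto simp: Q_def)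
qed

lemma forest_braid:
  "b \<in> braids \<Longrightarrow> \<exists>ks. \<exists>b'\<in>braids. forest js \<otimes>\<^bsub>B_bullet\<^esub> b = b' \<otimes>\<^bsub>B_bullet\<^esub> forest ks"
proof (induction js)
  case Nil
  then show ?case by (intro exI [of _ "[]"] bexI [of _ b]) simp_all
next
  case (Cons j js)
  then obtain ks b' where b': "b' \<in> braids" "forest js \<otimes>\<^bsub>B_bullet\<^esub> b = b' \<otimes>\<^bsub>B_bullet\<^esub> forest ks"
    by blast
  obtain k b'' where b'': "b'' \<in> braids" "alp j \<otimes>\<^bsub>B_bullet\<^esub> b' = b'' \<otimes>\<^bsub>B_bullet\<^esub> alp k"
    using alp_braid(1) [OF b'(1)] by blast
  have "forest (j # js) \<otimes>\<^bsub>B_bullet\<^esub> b = alp j \<otimes>\<^bsub>B_bullet\<^esub> b' \<otimes>\<^bsub>B_bullet\<^esub> forest ks"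
    using b' Cons.prems by (simp add: B.m_assoc)
  also have "\<dots> = b'' \<otimes>\<^bsub>B_bullet\<^esub> forest (k # ks)"
    using b'' by (simp add: B.m_assoc)
  finally show ?case using b''(1) by blast
qed

lemma braid_inv_forest:
  "b \<in> braids \<Longrightarrow> \<exists>ks. \<exists>b'\<in>braids.
    b \<otimes>\<^bsub>B_bullet\<^esub> inv\<^bsub>B_bullet\<^esub> forest js = inv\<^bsub>B_bullet\<^esub> forest ks \<otimes>\<^bsub>B_bullet\<^esub> b'"
proof (induction js arbitrary: b rule: rev_induct)
  case Nil
  then show ?case by (intro exI [of _ "[]"] bexI [of _ b]) simp_all
next
  case (snoc j js)
  obtain k b' where b': "b' \<in> braids" "alp k \<otimes>\<^bsub>B_bullet\<^esub> b = b' \<otimes>\<^bsub>B_bullet\<^esub> alp j"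
    using alp_braid(2) [OF snoc.prems] by blast
  obtain ks b'' where b'': "b'' \<in> braids"
    "b' \<otimes>\<^bsub>B_bullet\<^esub> inv\<^bsub>B_bullet\<^esub> forest js = inv\<^bsub>B_bullet\<^esub> forest ks \<otimes>\<^bsub>B_bullet\<^esub> b''"
    using snoc.IH [OF b'(1)] by blast
  have "b = inv\<^bsub>B_bullet\<^esub> alp k \<otimes>\<^bsub>B_bullet\<^esub> (b' \<otimes>\<^bsub>B_bullet\<^esub> alp j)"
    using snoc.prems by (simp add: braid.cancel_left flip: b'(2))
  then have "b \<otimes>\<^bsub>B_bullet\<^esub> inv\<^bsub>B_bullet\<^esub> forest (js @ [j]) =
      inv\<^bsub>B_bullet\<^esub> alp k \<otimes>\<^bsub>B_bullet\<^esub> (b' \<otimes>\<^bsub>B_bullet\<^esub> inv\<^bsub>B_bullet\<^esub> forest js)"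
    using b'(1) by (simp add: forest_append B.inv_mult_group B.m_assoc braid.cancel_left)
  also have "\<dots> = inv\<^bsub>B_bullet\<^esub> forest (ks @ [k]) \<otimes>\<^bsub>B_bullet\<^esub> b''"
    using b'' by (simp add: forest_append B.inv_mult_group B.m_assoc)
  finally show ?case using b''(1) by blast
qed

text \<open>The relation between two a's gives \<open>alp i\<close> and \<open>alp j\<close> a
  common left multiple, the Ore condition behind the fractions.\<close>

lemma alp_inv_alp:
  assumes "i \<noteq> j"
  shows "\<exists>k l. alp i \<otimes>\<^bsub>B_bullet\<^esub> inv\<^bsub>B_bullet\<^esub> alp j = inv\<^bsub>B_bullet\<^esub> alp k \<otimes>\<^bsub>B_bullet\<^esub> alp l"
proof -
  obtain k l where "alp k \<otimes>\<^bsub>B_bullet\<^esub> alp i = alp l \<otimes>\<^bsub>B_bullet\<^esub> alp j"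
    using assms B_relations(3) by (metis linorder_neqE_nat)
  then have "alp i = inv\<^bsub>B_bullet\<^esub> alp k \<otimes>\<^bsub>B_bullet\<^esub> (alp l \<otimes>\<^bsub>B_bullet\<^esub> alp j)"
    by (metis alp_closed braid.cancel_left(2))
  then have "alp i \<otimes>\<^bsub>B_bullet\<^esub> inv\<^bsub>B_bullet\<^esub> alp j = inv\<^bsub>B_bullet\<^esub> alp k \<otimes>\<^bsub>B_bullet\<^esub> alp l"
    by (simp add: B.m_assoc)
  then show ?thesis by blast
qed

text \<open>The leftmost letter of the inverse forest comes from the end of \<open>js\<close>. It
  either cancels \<open>alp i\<close> or is exchanged with it, up to indices.\<close>

lemma alp_inv_forest:
  "\<exists>ks ls. alp i \<otimes>\<^bsub>B_bullet\<^esub> inv\<^bsub>B_bullet\<^esub> forest js = inv\<^bsub>B_bullet\<^esub> forest ks \<otimes>\<^bsub>B_bullet\<^esub> forest ls"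
proof (induction js arbitrary: i rule: rev_induct)
  case Nil
  then show ?case by (intro exI [of _ "[]"] exI [of _ "[i]"]) simp
next
  case (snoc j js)
  show ?case
  proof (cases "i = j")
    case True
    then show ?thesis
      by (intro exI [of _ "js"] exI [of _ "[]"])
         (simp add: forest_append B.inv_mult_group braid.cancel_left)
  next
    case False
    then obtain k l where kl: "alp i \<otimes>\<^bsub>B_bullet\<^esub> inv\<^bsub>B_bullet\<^esub> alp j = inv\<^bsub>B_bullet\<^esub> alp k \<otimes>\<^bsub>B_bullet\<^esub> alp l"
      using alp_inv_alp by blast
    obtain ks ls where ks: "alp l \<otimes>\<^bsub>B_bullet\<^esub> inv\<^bsub>B_bullet\<^esub> forest js =
        inv\<^bsub>B_bullet\<^esub> forest ks \<otimes>\<^bsub>B_bullet\<^esub> forest ls"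
      using snoc.IH by blast
    have "alp i \<otimes>\<^bsub>B_bullet\<^esub> inv\<^bsub>B_bullet\<^esub> forest (js @ [j]) =
        inv\<^bsub>B_bullet\<^esub> alp k \<otimes>\<^bsub>B_bullet\<^esub> alp l \<otimes>\<^bsub>B_bullet\<^esub> inv\<^bsub>B_bullet\<^esub> forest js"
      by (simp add: forest_append B.inv_mult_group B.m_assoc [symmetric] kl)
    also have "\<dots> = inv\<^bsub>B_bullet\<^esub> forest (ks @ [k]) \<otimes>\<^bsub>B_bullet\<^esub> forest ls"
      by (simp add: forest_append B.inv_mult_group B.m_assoc ks)
    finally show ?thesis by blast
  qed
qed

lemma B_left_induct:
  assumes "g \<in> carrier B_bullet" "Z \<subseteq> carrier B_bullet" "\<one>\<^bsub>B_bullet\<^esub> \<in> Z"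
    and Z: "\<And>i z. z \<in> Z \<Longrightarrow> sig i \<otimes>\<^bsub>B_bullet\<^esub> z \<in> Z"
      "\<And>i z. z \<in> Z \<Longrightarrow> inv\<^bsub>B_bullet\<^esub> sig i \<otimes>\<^bsub>B_bullet\<^esub> z \<in> Z"
      "\<And>i z. z \<in> Z \<Longrightarrow> alp i \<otimes>\<^bsub>B_bullet\<^esub> z \<in> Z"
      "\<And>i z. z \<in> Z \<Longrightarrow> inv\<^bsub>B_bullet\<^esub> alp i \<otimes>\<^bsub>B_bullet\<^esub> z \<in> Z"
  shows "g \<in> Z"
proof -
  have inv: "pres_class pb_gens pb_rels [(x, False)] = inv\<^bsub>B_bullet\<^esub> pres_class pb_gens pb_rels [(x, True)]"
    if "x \<in> pb_gens" for x
    using that pres_cong.cancel [of x pb_gens False pb_rels]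
    by (intro B.inv_equality [symmetric])
       (auto simp: B_bullet_def presented_group_one pres_class_eq_iff)
  have "pres_class pb_gens pb_rels w \<in> Z" if "w \<in> words pb_gens" for w
    using that
  proof (induction w)
    case Nil
    then show ?case using assms(3) by (simp add: B_bullet_def presented_group_one)
  next
    case (Cons y w)
    obtain x b where y: "y = (x, b)" by force
    have x: "x \<in> pb_gens" and w: "w \<in> words pb_gens" using Cons.prems y by auto
    have "pres_class pb_gens pb_rels (y # w) =
        pres_class pb_gens pb_rels [(x, b)] \<otimes>\<^bsub>B_bullet\<^esub> pres_class pb_gens pb_rels w"
      using x w by (simp add: B_bullet_def y)
    moreover obtain i where "x = Sig (Suc i) \<or> x = Alpha (Suc i)"
      using x by (auto simp: pb_gens_def) (metis Suc_le_D One_nat_def)+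
    ultimately show ?case
      using Cons.IH [OF w] Z inv [OF x] by (cases b) (auto simp: sig_def alp_def)
  qed
  then show ?thesis using assms(1) by (auto simp: B_bullet_def elim: presented_group_cases)
qed

text \<open>Such fractions are stable under left multiplication by generators and their inverses: an
  \<open>alp i\<close> passes the denominator by \<open>alp_inv_forest\<close>, the result passes
  the braid, and what remains joins the numerator.\<close>

lemma fraction_decomposition:
  assumes "g \<in> carrier B_bullet"
  obtains js b ks where "b \<in> braids"
    "g = inv\<^bsub>B_bullet\<^esub> forest js \<otimes>\<^bsub>B_bullet\<^esub> (b \<otimes>\<^bsub>B_bullet\<^esub> forest ks)"
proof -
  define Z where "Z = {inv\<^bsub>B_bullet\<^esub> forest js \<otimes>\<^bsub>B_bullet\<^esub> (b \<otimes>\<^bsub>B_bullet\<^esub> forest ks) | js b ks. b \<in> braids}"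
  have ZI: "inv\<^bsub>B_bullet\<^esub> forest js \<otimes>\<^bsub>B_bullet\<^esub> (b \<otimes>\<^bsub>B_bullet\<^esub> forest ks) \<in> Z" if "b \<in> braids" for js b ks
    using that by (auto simp: Z_def)
  have braid: "c \<otimes>\<^bsub>B_bullet\<^esub> z \<in> Z" if c: "c \<in> braids" and "z \<in> Z" for c z
  proof -
    obtain js b ks where z: "z = inv\<^bsub>B_bullet\<^esub> forest js \<otimes>\<^bsub>B_bullet\<^esub> (b \<otimes>\<^bsub>B_bullet\<^esub> forest ks)" "b \<in> braids"
      using \<open>z \<in> Z\<close> by (auto simp: Z_def)
    obtain ls c' where c': "c' \<in> braids"
      "c \<otimes>\<^bsub>B_bullet\<^esub> inv\<^bsub>B_bullet\<^esub> forest js = inv\<^bsub>B_bullet\<^esub> forest ls \<otimes>\<^bsub>B_bullet\<^esub> c'"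
      using braid_inv_forest [OF c] by blast
    have "c \<otimes>\<^bsub>B_bullet\<^esub> z = inv\<^bsub>B_bullet\<^esub> forest ls \<otimes>\<^bsub>B_bullet\<^esub> c' \<otimes>\<^bsub>B_bullet\<^esub> (b \<otimes>\<^bsub>B_bullet\<^esub> forest ks)"
      using z c c'(1) by (simp add: B.m_assoc [symmetric] c'(2))
    also have "\<dots> = inv\<^bsub>B_bullet\<^esub> forest ls \<otimes>\<^bsub>B_bullet\<^esub> ((c' \<otimes>\<^bsub>B_bullet\<^esub> b) \<otimes>\<^bsub>B_bullet\<^esub> forest ks)"
      using z c'(1) by (simp add: B.m_assoc)
    finally show ?thesis using ZI braids_mult [OF c'(1) z(2)] by simp
  qed
  have "g \<in> Z"
  proof (rule B_left_induct [OF assms])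
    show "Z \<subseteq> carrier B_bullet" by (auto simp: Z_def)
    show "\<one>\<^bsub>B_bullet\<^esub> \<in> Z" using ZI [OF braids_one, of "[]" "[]"] by simp
  next
    fix i z assume "z \<in> Z"
    then obtain js b ks where z: "z = inv\<^bsub>B_bullet\<^esub> forest js \<otimes>\<^bsub>B_bullet\<^esub> (b \<otimes>\<^bsub>B_bullet\<^esub> forest ks)" "b \<in> braids"
      by (auto simp: Z_def)
    show "sig i \<otimes>\<^bsub>B_bullet\<^esub> z \<in> Z" "inv\<^bsub>B_bullet\<^esub> sig i \<otimes>\<^bsub>B_bullet\<^esub> z \<in> Z"
      using braid [OF braids_sig \<open>z \<in> Z\<close>] braid [OF braids_inv [OF braids_sig] \<open>z \<in> Z\<close>] by blast+
    have "inv\<^bsub>B_bullet\<^esub> alp i \<otimes>\<^bsub>B_bullet\<^esub> z =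
        inv\<^bsub>B_bullet\<^esub> forest (js @ [i]) \<otimes>\<^bsub>B_bullet\<^esub> (b \<otimes>\<^bsub>B_bullet\<^esub> forest ks)"
      using z by (simp add: forest_append B.inv_mult_group B.m_assoc)
    then show "inv\<^bsub>B_bullet\<^esub> alp i \<otimes>\<^bsub>B_bullet\<^esub> z \<in> Z" using ZI z(2) by simp
    obtain ls ms where ls: "alp i \<otimes>\<^bsub>B_bullet\<^esub> inv\<^bsub>B_bullet\<^esub> forest js =
        inv\<^bsub>B_bullet\<^esub> forest ls \<otimes>\<^bsub>B_bullet\<^esub> forest ms"
      using alp_inv_forest by blast
    obtain ns b' where b': "b' \<in> braids" "forest ms \<otimes>\<^bsub>B_bullet\<^esub> b = b' \<otimes>\<^bsub>B_bullet\<^esub> forest ns"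
      using forest_braid [OF z(2)] by blast
    have "alp i \<otimes>\<^bsub>B_bullet\<^esub> z = alp i \<otimes>\<^bsub>B_bullet\<^esub> inv\<^bsub>B_bullet\<^esub> forest js \<otimes>\<^bsub>B_bullet\<^esub> (b \<otimes>\<^bsub>B_bullet\<^esub> forest ks)"
      using z by (simp add: B.m_assoc)
    also have "\<dots> = inv\<^bsub>B_bullet\<^esub> forest ls \<otimes>\<^bsub>B_bullet\<^esub> (forest ms \<otimes>\<^bsub>B_bullet\<^esub> b \<otimes>\<^bsub>B_bullet\<^esub> forest ks)"
      unfolding ls using z(2) by (simp add: B.m_assoc)
    also have "\<dots> = inv\<^bsub>B_bullet\<^esub> forest ls \<otimes>\<^bsub>B_bullet\<^esub> (b' \<otimes>\<^bsub>B_bullet\<^esub> forest (ns @ ks))"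
      unfolding b'(2) using b'(1) by (simp add: forest_append B.m_assoc)
    finally show "alp i \<otimes>\<^bsub>B_bullet\<^esub> z \<in> Z" using ZI [OF b'(1)] by simp
  qed
  then show thesis using that by (auto simp: Z_def)
qed

section \<open>Recovering a forest from its action\<close>

lemma psi_alp_x1:
  "psi (alp i) (x1 j) = (if j < i then x1 j else if j = i then x1 j \<otimes>\<^bsub>F_bullet\<^esub> x1 (Suc j) else x1 (Suc j))"
  by auto

text \<open>The last letter acts first and turns \<open>x1 j\<close> into one such element or a
  product of two, each of width at least one by induction.\<close>

lemma forest_width_pos: "deg UNIV (psi (forest js) (x1 j)) \<ge> 1"
proof (induction js arbitrary: j rule: rev_induct)
  case (snoc k js)
  show ?case
    using snoc.IH [of j] snoc.IH [of "Suc j"]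
    by (auto simp: forest_append psi_alp_x1 simp del: psi_alp)
qed simp

lemma forest_width_snoc: "deg UNIV (psi (forest (js @ [j])) (x1 j)) \<ge> 2"
  using forest_width_pos [of js j] forest_width_pos [of js "Suc j"]
  by (simp add: forest_append psi_alp_x1 del: psi_alp)

text \<open>A converse to \<open>forest_width_snoc\<close>. A last letter other than
  \<open>alp j\<close> keeps \<open>x1 j\<close> or renames it to \<open>x1 (Suc j)\<close>, so by
  induction the shorter forest ends in the corresponding letter, and the relation between two a's
  swaps the last two.\<close>

lemma forest_split:
  "deg UNIV (psi (forest js) (x1 j)) \<ge> 2 \<Longrightarrow> \<exists>ks. forest js = forest (ks @ [j])"
proof (induction js arbitrary: j rule: rev_induct)
  case (snoc k js)
  consider "k = j" | "k < j" | "j < k" by linarith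
  then show ?case
  proof cases
    case 2
    then obtain ks where "forest js = forest (ks @ [Suc j])"
      using snoc by (force simp: forest_append psi_alp_x1 simp del: psi_alp)
    then have "forest (js @ [k]) = forest ((ks @ [k]) @ [j])"
      using B_relations(3) [OF 2] by (simp add: forest_append B.m_assoc)
    then show ?thesis by blast
  next
    case 3
    then obtain ks where "forest js = forest (ks @ [j])"
      using snoc by (force simp: forest_append psi_alp_x1 simp del: psi_alp)
    then have "forest (js @ [k]) = forest ((ks @ [Suc k]) @ [j])"
      using B_relations(3) [OF 3] by (simp add: forest_append B.m_assoc)
    then show ?thesis by blast
  qed blast
qed simp

text \<open>Braids preserve widths. So a last letter \<open>alp k\<close> of
  \<open>forest ks\<close> forces width at least two at \<open>x1 k\<close> under
  \<open>forest js\<close>, which then also ends in \<open>alp k\<close> up to the relations. With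
  \<open>ks\<close> empty all widths are one, so \<open>js\<close> is empty and
  \<open>braid_faithful\<close> applies.\<close>

lemma braid_forest_cancel:
  "b \<in> braids \<Longrightarrow> (\<And>c. c \<in> carrier F_bullet \<Longrightarrow> psi b (psi (forest ks) c) = psi (forest js) c) \<Longrightarrow>
    b \<otimes>\<^bsub>B_bullet\<^esub> forest ks = forest js"
proof (induction ks arbitrary: js rule: rev_induct)
  case Nil
  have "js = []"
  proof (cases js rule: rev_exhaust)
    case (snoc ls i)
    have "deg UNIV (psi (forest js) (x1 i)) = deg UNIV (x1 i)"
      using Nil.prems(2) [of "x1 i"] deg_psi_braid [OF Nil.prems(1), of "x1 i"] by simp
    then show ?thesis using forest_width_snoc [of ls i] snoc by simp
  qed
  then have "b = \<one>\<^bsub>B_bullet\<^esub>"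
    using Nil.prems by (intro braid_faithful) simp_all
  then show ?case using \<open>js = []\<close> by simp
next
  case (snoc k ks)
  have "deg UNIV (psi (forest js) (x1 k)) = deg UNIV (psi (forest (ks @ [k])) (x1 k))"
    using snoc.prems(2) [of "x1 k"] deg_psi_braid [OF snoc.prems(1), of "psi (forest (ks @ [k])) (x1 k)"]
    by simp
  then obtain ls where ls: "forest js = forest (ls @ [k])"
    using forest_split [of js k] forest_width_snoc [of ks k] by auto
  have "b \<otimes>\<^bsub>B_bullet\<^esub> forest ks = forest ls"
  proof (rule snoc.IH [OF snoc.prems(1)])
    fix c assume c: "c \<in> carrier F_bullet"
    \<comment> \<open>Evaluating at the preimage of \<open>c\<close> under
      \<open>psi (alp k)\<close> removes the common last letter.\<close>
    then show "psi b (psi (forest ks) c) = psi (forest ls) c"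
      using snoc.prems(2) [of "psi (inv\<^bsub>B_bullet\<^esub> alp k) c"] by (simp add: ls forest_append)
  qed
  then show ?case
    using snoc.prems(1) by (simp add: ls forest_append B.m_assoc [symmetric])
qed

theorem proposition5p11:
  shows "psi \<in> mon B_bullet (AutoGroup F_bullet)"
proof -
  interpret psi: group_hom B_bullet "AutoGroup F_bullet" psi
    by (intro group_hom.intro group_hom_axioms.intro B.is_group F.AutoGroup psi_hom)
  have "g = \<one>\<^bsub>B_bullet\<^esub>" if g: "g \<in> carrier B_bullet" and "psi g = \<one>\<^bsub>AutoGroup F_bullet\<^esub>" for g
  proof -
    have id: "psi g c = c" if "c \<in> carrier F_bullet" for c
      using \<open>psi g = _\<close> that by (simp add: AutoGroup_simps)
    obtain js b ks where b: "b \<in> braids"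
      and gd: "g = inv\<^bsub>B_bullet\<^esub> forest js \<otimes>\<^bsub>B_bullet\<^esub> (b \<otimes>\<^bsub>B_bullet\<^esub> forest ks)"
      using fraction_decomposition [OF g] .
    have "forest js \<otimes>\<^bsub>B_bullet\<^esub> g = b \<otimes>\<^bsub>B_bullet\<^esub> forest ks"
      using b by (simp add: gd braid.cancel_left)
    then have "psi b (psi (forest ks) c) = psi (forest js) c" if "c \<in> carrier F_bullet" for c
      using psi_mult [of "forest js" g c] psi_mult [of b "forest ks" c] b g id that by simp
    then have "b \<otimes>\<^bsub>B_bullet\<^esub> forest ks = forest js"
      by (rule braid_forest_cancel [OF b])
    then show ?thesis by (simp add: gd)
  qed
  then have "inj_on psi (carrier B_bullet)"
    by (intro psi.inj_on_one_iff [THEN iffD2]) blast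
  then show ?thesis using psi_hom by (simp add: mon_def)
qed

end
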